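(* Let $R$ be the homogeneous coordinate ring of a $0$-dimensional scheme $\mathbb{X}\subseteq\mathbb{P}^n$ as in the context, let $\epsilon:\Omega^1_{R/K}\to\mathfrak{m}$ be the Euler form and $U_{R/K}\subseteq\Omega^1_{R/K}$ the Koszul submodule. Then: (a) We have $U_{R/K}\subseteq\mathrm{Ker}(\epsilon)$, and this is an equality if $\mathrm{char}(K)=0$ or $\mathrm{char}(K)\ge 2r_{\mathbb{X}}+1$. (b) Assume that $\mathrm{char}(K)=p>0$. If $i\ge1$ satisfies $p\nmid i$ or if $i\ge 2r_{\mathbb{X}}+1$, then $(U_{R/K})_i=\mathrm{Ker}(\epsilon)_i$. (c) $\mathrm{Ker}(\epsilon)=\{w\in\Omega^1_{R/K}\mid x_0w\in U_{R/K}\}$.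
   Context: Let $K$ be a perfect field, $n\ge 1$, $P=K[X_0,\dots,X_n]$ with the standard grading, and $\mathbb{X}\subseteq\mathbb{P}^n$ a $0$-dimensional subscheme over $K$ with saturated homogeneous vanishing ideal $I_{\mathbb{X}}$. Put $R=P/I_{\mathbb{X}}$, let $x_i$ be the image of $X_i$ in $R$, and let $\mathfrak{m}=\langle x_0,\dots,x_n\rangle\subseteq R$. Assume no point of the support of $\mathbb{X}$ lies on the hyperplane $X_0=0$; then $x_0$ is a non-zerodivisor of $R$. Let $\mathrm{HF}_{\mathbb{X}}(i)=\dim_K R_i$, $\deg(\mathbb{X})$ its constant value for $i\gg0$, and $r_{\mathbb{X}}$ the least integer with $\mathrm{HF}_{\mathbb{X}}(i)=\deg(\mathbb{X})$ for all $i\ge r_{\mathbb{X}}$. $\Omega^1_{R/K}$ is the module of Kähler differentials, graded with $\deg(dx_i)=1$. The Euler form is the surjective $R$-linear map $\epsilon:\Omega^1_{R/K}\to\mathfrak{m}$ with $\epsilon(dx_i)=x_i$ for $i=0,\dots,n$ (it is induced by the Euler derivation $\delta(f)=i\cdot f$ for $f\in R_i$). The Koszul submodule is the graded $R$-submodule $U_{R/K}=\langle x_i\,dx_j-x_j\,dx_i\mid 0\le i<j\le n\rangle$ of $\Omega^1_{R/K}$. *)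

theory Defs
  imports
    "HOL-Library.Poly_Mapping"
    "HOL-Library.FuncSet"
    "HOL-Algebra.QuotRing"
    "HOL-Algebra.Ideal_Product"
    "HOL-Algebra.Embedded_Algebras"
    "HOL-Algebra.Module"
begin

definition perfect_field :: "'k::field itself \<Rightarrow> bool" where
  "perfect_field _ \<longleftrightarrow> CHAR('k) = 0 \<or> (\<forall>a::'k. \<exists>b. b ^ CHAR('k) = a)"


section \<open>The graded polynomial ring\<close>

text \<open>A monomial is its exponent vector and a polynomial is a finitely supported function from
  monomials to coefficients; the ring \<open>K[X\<^sub>0,\<dots>,X\<^sub>n]\<close> consists of those polynomials in which only
  the indices \<open>0,\<dots>,n\<close> occur.\<close>

type_synonym 'k mpoly = "(nat \<Rightarrow>\<^sub>0 nat) \<Rightarrow>\<^sub>0 'k"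

definition pring :: "nat \<Rightarrow> 'k::field mpoly ring" where
  "pring n = \<lparr>carrier = {f. \<forall>m\<in>Poly_Mapping.keys f. Poly_Mapping.keys m \<subseteq> {..n}},
     mult = (*), one = 1, zero = 0, add = (+)\<rparr>"

definition pvar :: "nat \<Rightarrow> 'k::field mpoly" where
  "pvar j = Poly_Mapping.single (Poly_Mapping.single j 1) 1"

definition pconst :: "'k::field \<Rightarrow> 'k mpoly" where
  "pconst c = Poly_Mapping.single 0 c"

definition mon_deg :: "(nat \<Rightarrow>\<^sub>0 nat) \<Rightarrow> nat" where
  "mon_deg m = (\<Sum>j\<in>Poly_Mapping.keys m. Poly_Mapping.lookup m j)"

definition ppart :: "nat \<Rightarrow> nat \<Rightarrow> 'k::field mpoly set" where
  "ppart n d = {f \<in> carrier (pring n). \<forall>m\<in>Poly_Mapping.keys f. mon_deg m = d}"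

definition irrelevant_ideal :: "nat \<Rightarrow> 'k::field mpoly set" where
  "irrelevant_ideal n = Idl\<^bsub>pring n\<^esub> (pvar ` {..n})"

definition homogeneous_ideal :: "nat \<Rightarrow> 'k::field mpoly set \<Rightarrow> bool" where
  "homogeneous_ideal n I \<longleftrightarrow> ideal I (pring n) \<and> I = Idl\<^bsub>pring n\<^esub> (I \<inter> (\<Union>d. ppart n d))"

definition ideal_pow :: "('a, 'b) ring_scheme \<Rightarrow> 'a set \<Rightarrow> nat \<Rightarrow> 'a set" where
  "ideal_pow R J k = (ideal_prod R J ^^ k) (carrier R)"

definition saturated :: "nat \<Rightarrow> 'k::field mpoly set \<Rightarrow> bool" where
  "saturated n I \<longleftrightarrow>
     {f \<in> carrier (pring n).
        \<exists>k. \<forall>g\<in>ideal_pow (pring n) (irrelevant_ideal n) k. f \<otimes>\<^bsub>pring n\<^esub> g \<in> I} = I"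


section \<open>Closed subschemes of projective space\<close>

text \<open>A closed subscheme of \<open>\<P>\<^sup>n\<close> over \<open>K\<close> is represented by its saturated homogeneous vanishing
  ideal \<open>I\<close>. The points of its support are the points of \<open>Proj (P/I)\<close>, i.e. the homogeneous
  primes of \<open>P\<close> that contain \<open>I\<close> and do not contain the irrelevant ideal.\<close>

definition scheme_points :: "nat \<Rightarrow> 'k::field mpoly set \<Rightarrow> 'k mpoly set set" where
  "scheme_points n I = {\<pp>. primeideal \<pp> (pring n) \<and> homogeneous_ideal n \<pp> \<and>
     \<not> irrelevant_ideal n \<subseteq> \<pp> \<and> I \<subseteq> \<pp>}"

text \<open>The irreducible closed subsets of the support are the closures of its points, with
  inclusions reversed. Hence dimension 0 means: the support is nonempty and has no strict chain
  of two such primes.\<close>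

definition zero_dimensional :: "nat \<Rightarrow> 'k::field mpoly set \<Rightarrow> bool" where
  "zero_dimensional n I \<longleftrightarrow> scheme_points n I \<noteq> {} \<and>
     (\<forall>\<pp>\<in>scheme_points n I. \<forall>\<qq>\<in>scheme_points n I. \<not> \<pp> \<subset> \<qq>)"

definition zero_dim_subscheme :: "nat \<Rightarrow> 'k::field mpoly set \<Rightarrow> bool" where
  "zero_dim_subscheme n I \<longleftrightarrow> homogeneous_ideal n I \<and> saturated n I \<and> zero_dimensional n I"


section \<open>The homogeneous coordinate ring\<close>

definition coord_ring :: "nat \<Rightarrow> 'k::field mpoly set \<Rightarrow> 'k mpoly set ring" where
  "coord_ring n I = pring n Quot I"

definition rclass :: "nat \<Rightarrow> 'k::field mpoly set \<Rightarrow> 'k mpoly \<Rightarrow> 'k mpoly set" where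
  "rclass n I f = I +>\<^bsub>pring n\<^esub> f"

definition rvar :: "nat \<Rightarrow> 'k::field mpoly set \<Rightarrow> nat \<Rightarrow> 'k mpoly set" where
  "rvar n I j = rclass n I (pvar j)"

text \<open>The image of \<open>K\<close> in \<open>R = P/I\<close>.\<close>

definition rscalars :: "nat \<Rightarrow> 'k::field mpoly set \<Rightarrow> 'k mpoly set set" where
  "rscalars n I = rclass n I ` range pconst"

definition rpart :: "nat \<Rightarrow> 'k::field mpoly set \<Rightarrow> nat \<Rightarrow> 'k mpoly set set" where
  "rpart n I d = rclass n I ` ppart n d"

definition max_ideal :: "nat \<Rightarrow> 'k::field mpoly set \<Rightarrow> 'k mpoly set set" where
  "max_ideal n I = Idl\<^bsub>coord_ring n I\<^esub> (rvar n I ` {..n})"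

definition hilbert_fun :: "nat \<Rightarrow> 'k::field mpoly set \<Rightarrow> nat \<Rightarrow> nat" where
  "hilbert_fun n I d = ring.dim (coord_ring n I) (rscalars n I) (rpart n I d)"

definition scheme_deg :: "nat \<Rightarrow> 'k::field mpoly set \<Rightarrow> nat" where
  "scheme_deg n I = (THE e. \<forall>\<^sub>F d in sequentially. hilbert_fun n I d = e)"

text \<open>For a nonempty scheme the degree is positive while \<open>R\<close> vanishes in negative degrees, so the
  least integer in the definition of the regularity index is a natural number.\<close>

definition reg_index :: "nat \<Rightarrow> 'k::field mpoly set \<Rightarrow> nat" where
  "reg_index n I = (LEAST r. \<forall>d\<ge>r. hilbert_fun n I d = scheme_deg n I)"


section \<open>Modules\<close>

text \<open>In the module records below the ring fields \<^const>\<open>mult\<close> and \<^const>\<open>one\<close> carry no meaning.\<close>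

definition submod_gen ::
  "('r, 'm) ring_scheme \<Rightarrow> ('r, 'a, 'l) module_scheme \<Rightarrow> 'a set \<Rightarrow> 'a set" where
  "submod_gen R M S = (\<lambda>N. submodule N R M) hull S"

definition quot_module :: "('r, 'a, 'l) module_scheme \<Rightarrow> 'a set \<Rightarrow> ('r, 'a set) module" where
  "quot_module M N = \<lparr>carrier = a_rcosets\<^bsub>M\<^esub> N, mult = undefined, one = undefined,
     zero = N, add = (<+>\<^bsub>M\<^esub>),
     smult = (\<lambda>a X. \<Union>x\<in>X. N +>\<^bsub>M\<^esub> (a \<odot>\<^bsub>M\<^esub> x))\<rparr>"

text \<open>The free \<open>R\<close>-module with a basis indexed by the elements of \<open>S\<close>.\<close>

definition free_module :: "('r, 'm) ring_scheme \<Rightarrow> 's set \<Rightarrow> ('r, 's \<Rightarrow> 'r) module" where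
  "free_module R S = \<lparr>carrier = {\<phi>. range \<phi> \<subseteq> carrier R \<and>
       finite {s. \<phi> s \<noteq> \<zero>\<^bsub>R\<^esub>} \<and> {s. \<phi> s \<noteq> \<zero>\<^bsub>R\<^esub>} \<subseteq> S},
     mult = undefined, one = undefined,
     zero = (\<lambda>_. \<zero>\<^bsub>R\<^esub>), add = (\<lambda>\<phi> \<psi> s. \<phi> s \<oplus>\<^bsub>R\<^esub> \<psi> s), smult = (\<lambda>a \<phi> s. a \<otimes>\<^bsub>R\<^esub> \<phi> s)\<rparr>"

definition free_basis :: "('r, 'm) ring_scheme \<Rightarrow> 's \<Rightarrow> 's \<Rightarrow> 'r" where
  "free_basis R s = (\<lambda>t. if t = s then \<one>\<^bsub>R\<^esub> else \<zero>\<^bsub>R\<^esub>)"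


section \<open>Kaehler differentials\<close>

text \<open>For a subring \<open>A\<close> of \<open>R\<close>, the module \<open>\<Omega>\<^sup>1\<close> of \<open>R\<close> over \<open>A\<close> is the quotient of the free module
  on symbols \<open>e r\<close> (\<open>r \<in> R\<close>) by additivity, the Leibniz rule and the vanishing of the symbols
  \<open>e a\<close> (\<open>a \<in> A\<close>); the universal derivation sends \<open>r\<close> to the class of \<open>e r\<close>.\<close>

definition kaehler_relations :: "('r, 'm) ring_scheme \<Rightarrow> 'r set \<Rightarrow> ('r \<Rightarrow> 'r) set" where
  "kaehler_relations R A =
    (let F = free_module R (carrier R); e = free_basis R in
      {e (r \<oplus>\<^bsub>R\<^esub> s) \<ominus>\<^bsub>F\<^esub> (e r \<oplus>\<^bsub>F\<^esub> e s) | r s. r \<in> carrier R \<and> s \<in> carrier R} \<union>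
      {e (r \<otimes>\<^bsub>R\<^esub> s) \<ominus>\<^bsub>F\<^esub> (r \<odot>\<^bsub>F\<^esub> e s \<oplus>\<^bsub>F\<^esub> s \<odot>\<^bsub>F\<^esub> e r) | r s. r \<in> carrier R \<and> s \<in> carrier R} \<union>
      e ` A)"

definition kaehler_kernel :: "('r, 'm) ring_scheme \<Rightarrow> 'r set \<Rightarrow> ('r \<Rightarrow> 'r) set" where
  "kaehler_kernel R A = submod_gen R (free_module R (carrier R)) (kaehler_relations R A)"

definition kaehler :: "('r, 'm) ring_scheme \<Rightarrow> 'r set \<Rightarrow> ('r, ('r \<Rightarrow> 'r) set) module" where
  "kaehler R A = quot_module (free_module R (carrier R)) (kaehler_kernel R A)"

definition kaehler_d :: "('r, 'm) ring_scheme \<Rightarrow> 'r set \<Rightarrow> 'r \<Rightarrow> ('r \<Rightarrow> 'r) set" where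
  "kaehler_d R A r = kaehler_kernel R A +>\<^bsub>free_module R (carrier R)\<^esub> free_basis R r"

type_synonym 'k diff = "('k mpoly set \<Rightarrow> 'k mpoly set) set"

definition Omega :: "nat \<Rightarrow> 'k::field mpoly set \<Rightarrow> ('k mpoly set, 'k diff) module" where
  "Omega n I = kaehler (coord_ring n I) (rscalars n I)"

definition dvar :: "nat \<Rightarrow> 'k::field mpoly set \<Rightarrow> nat \<Rightarrow> 'k diff" where
  "dvar n I j = kaehler_d (coord_ring n I) (rscalars n I) (rvar n I j)"

text \<open>The grading with \<open>deg (dx\<^sub>j) = 1\<close>: since the \<open>dx\<^sub>j\<close> generate, the component of degree \<open>d\<close> is
  \<open>\<Sum>\<^sub>j R\<^bsub>d-1\<^esub> dx\<^sub>j\<close>, which is zero for \<open>d = 0\<close>.\<close>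

definition omega_part :: "nat \<Rightarrow> 'k::field mpoly set \<Rightarrow> nat \<Rightarrow> 'k diff set" where
  "omega_part n I d = (if d = 0 then {\<zero>\<^bsub>Omega n I\<^esub>} else
     {\<Oplus>\<^bsub>Omega n I\<^esub>j\<in>{..n}. f j \<odot>\<^bsub>Omega n I\<^esub> dvar n I j | f. \<forall>j\<le>n. f j \<in> rpart n I (d - 1)})"


section \<open>The Euler form and the Koszul submodule\<close>

definition linear_map ::
  "('r, 'm) ring_scheme \<Rightarrow> ('r, 'a, 'l) module_scheme \<Rightarrow> ('a \<Rightarrow> 'r) \<Rightarrow> bool" where
  "linear_map R M h \<longleftrightarrow> h \<in> carrier M \<rightarrow> carrier R \<and>
     (\<forall>u\<in>carrier M. \<forall>v\<in>carrier M. h (u \<oplus>\<^bsub>M\<^esub> v) = h u \<oplus>\<^bsub>R\<^esub> h v) \<and>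
     (\<forall>a\<in>carrier R. \<forall>u\<in>carrier M. h (a \<odot>\<^bsub>M\<^esub> u) = a \<otimes>\<^bsub>R\<^esub> h u)"

text \<open>Extensionality makes the map unique as a HOL function.\<close>

definition euler_form :: "nat \<Rightarrow> 'k::field mpoly set \<Rightarrow> 'k diff \<Rightarrow> 'k mpoly set" where
  "euler_form n I = (THE \<epsilon>. \<epsilon> \<in> extensional (carrier (Omega n I)) \<and>
     linear_map (coord_ring n I) (Omega n I) \<epsilon> \<and>
     \<epsilon> ` carrier (Omega n I) = max_ideal n I \<and>
     (\<forall>j\<le>n. \<epsilon> (dvar n I j) = rvar n I j))"

definition euler_kernel :: "nat \<Rightarrow> 'k::field mpoly set \<Rightarrow> 'k diff set" where
  "euler_kernel n I = a_kernel (Omega n I) (coord_ring n I) (euler_form n I)"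

definition koszul :: "nat \<Rightarrow> 'k::field mpoly set \<Rightarrow> 'k diff set" where
  "koszul n I = submod_gen (coord_ring n I) (Omega n I)
     {rvar n I i \<odot>\<^bsub>Omega n I\<^esub> dvar n I j \<ominus>\<^bsub>Omega n I\<^esub> rvar n I j \<odot>\<^bsub>Omega n I\<^esub> dvar n I i
        | i j. i < j \<and> j \<le> n}"

end

theory Submission
  imports Defs
begin

text \<open>Modulo the Koszul submodule \<open>U\<close> one has \<open>x\<^sub>j w \<equiv> \<epsilon>(w) dx\<^sub>j\<close> for every \<open>w\<close>, as is seen on the
  generators \<open>w = dx\<^sub>k\<close>. For \<open>j = 0\<close>, together with the fact that \<open>x\<^sub>0\<close> is a non-zerodivisor, this is (c).
  If \<open>w = \<Sum>\<^sub>j f\<^sub>j dx\<^sub>j\<close> is homogeneous of degree \<open>i\<close> and \<open>\<epsilon>(w) = \<Sum>\<^sub>j f\<^sub>j x\<^sub>j = 0\<close>, then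
  \<open>0 = d(\<Sum>\<^sub>j f\<^sub>j x\<^sub>j) = w + \<Sum>\<^sub>j x\<^sub>j df\<^sub>j \<equiv> w + \<Sum>\<^sub>j \<epsilon>(df\<^sub>j) dx\<^sub>j = w + (i - 1) w = i w\<close>,
  so \<open>w \<in> U\<close> whenever \<open>i\<close> is invertible in \<open>K\<close>. In degrees \<open>i \<ge> r + 2\<close>, where \<open>r\<close> is the regularity
  index, multiplication by \<open>x\<^sub>0\<close> maps \<open>R\<^bsub>i-2\<^esub>\<close> onto \<open>R\<^bsub>i-1\<^esub>\<close>, so \<open>w = x\<^sub>0 w'\<close> with \<open>\<epsilon>(w') = 0\<close>, and \<open>w \<in> U\<close> by (c).
  The degrees \<open>i \<ge> 2 r + 1\<close> divisible by \<open>p\<close> satisfy \<open>i \<ge> 2\<close>, hence \<open>i \<ge> r + 2\<close>.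

  A homogeneous ideal maximal among those that contain \<open>I + (X\<^sub>0)\<close> and miss all powers of \<open>X\<^sub>j\<close> would
  be a scheme point containing \<open>X\<^sub>0\<close>; hence a power of the irrelevant ideal lies in \<open>I + (X\<^sub>0)\<close>. By
  saturation \<open>x\<^sub>0\<close> is a non-zerodivisor. Moreover \<open>R\<^bsub>d+1\<^esub> = x\<^sub>0 R\<^sub>d\<close> for large \<open>d\<close>, so the Hilbert
  function is eventually constant, and comparing dimensions gives this equality for all \<open>d \<ge> r\<close>.\<close>

section \<open>Modules and Kaehler differentials\<close>

lemma (in module) submodule_zero:
  assumes "submodule N R M" shows "\<zero>\<^bsub>M\<^esub> \<in> N"
  using subgroup.one_closed[OF submodule.axioms(1)[OF assms]] by simp

text \<open>The hull is the intersection of all submodules containing \<open>S\<close>. Because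
  \<open>carrier M\<close> is among them, the intersection stays inside the module; the closure
  properties are inherited from each member.\<close>

lemma (in module) submod_gen_submodule:
  assumes "S \<subseteq> carrier M"
  shows "submodule (submod_gen R M S) R M"
proof (rule submoduleI)
  have car: "submodule (carrier M) R M" by (rule carrier_is_submodule)
  show "submod_gen R M S \<subseteq> carrier M"
    unfolding submod_gen_def using assms car by (rule hull_minimal)
  show "\<zero>\<^bsub>M\<^esub> \<in> submod_gen R M S"
    by (auto simp: submod_gen_def hull_def intro: submodule_zero)
  show "\<ominus>\<^bsub>M\<^esub> a \<in> submod_gen R M S" if "a \<in> submod_gen R M S" for a
    using that by (auto simp: submod_gen_def hull_def intro: submoduleE(3))
  show "a \<oplus>\<^bsub>M\<^esub> b \<in> submod_gen R M S" if "a \<in> submod_gen R M S" "b \<in> submod_gen R M S" for a b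
    using that by (auto simp: submod_gen_def hull_def intro: submoduleE(5))
  show "a \<odot>\<^bsub>M\<^esub> x \<in> submod_gen R M S" if "a \<in> carrier R" "x \<in> submod_gen R M S" for a x
    using that by (auto simp: submod_gen_def hull_def intro: submoduleE(4))
qed

lemma submod_gen_incl: "S \<subseteq> submod_gen R M S"
  unfolding submod_gen_def by (rule hull_subset)

lemma submod_gen_minimal: "S \<subseteq> N \<Longrightarrow> submodule N R M \<Longrightarrow> submod_gen R M S \<subseteq> N"
  unfolding submod_gen_def by (rule hull_minimal)

section \<open>Quotient modules\<close>

context module
begin

lemma submodule_abelian_subgroup:
  assumes "submodule N R M" shows "abelian_subgroup N M"
  by (intro abelian_subgroupI3 additive_subgroupI submodule.axioms(1)[OF assms] M.abelian_group_axioms)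

lemma submodule_coset_eq_iff:
  assumes N: "submodule N R M" and x: "x \<in> carrier M" and y: "y \<in> carrier M"
  shows "N +>\<^bsub>M\<^esub> x = N +>\<^bsub>M\<^esub> y \<longleftrightarrow> x \<ominus>\<^bsub>M\<^esub> y \<in> N"
proof -
  interpret N: abelian_subgroup N M by (rule submodule_abelian_subgroup[OF N])
  show ?thesis
  proof
    assume "N +>\<^bsub>M\<^esub> x = N +>\<^bsub>M\<^esub> y"
    then have "x \<in> N +>\<^bsub>M\<^esub> y" using N.a_rcos_self[OF x] by simp
    then show "x \<ominus>\<^bsub>M\<^esub> y \<in> N"
      using N.a_rcos_module_imp[OF y] by (simp add: a_minus_def)
  next
    assume "x \<ominus>\<^bsub>M\<^esub> y \<in> N"
    then have "x \<in> N +>\<^bsub>M\<^esub> y"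
      using N.a_rcos_module_rev[OF y x] by (simp add: M.minus_eq)
    then show "N +>\<^bsub>M\<^esub> x = N +>\<^bsub>M\<^esub> y"
      using M.a_repr_independence[OF _ y N.a_subgroup] by simp
  qed
qed

text \<open>Scalar multiplication on cosets is defined as a union over all representatives.
  Representatives differ by an element of \<open>N\<close>, hence so do their multiples, and the
  union is over equal cosets.\<close>

lemma quot_module_smult:
  assumes N: "submodule N R M" and a: "a \<in> carrier R" and x: "x \<in> carrier M"
  shows "a \<odot>\<^bsub>quot_module M N\<^esub> (N +>\<^bsub>M\<^esub> x) = N +>\<^bsub>M\<^esub> (a \<odot>\<^bsub>M\<^esub> x)"
proof -
  interpret N: abelian_subgroup N M by (rule submodule_abelian_subgroup[OF N])
  have "N +>\<^bsub>M\<^esub> (a \<odot>\<^bsub>M\<^esub> y) = N +>\<^bsub>M\<^esub> (a \<odot>\<^bsub>M\<^esub> x)" if y: "y \<in> N +>\<^bsub>M\<^esub> x" for y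
  proof -
    have yM: "y \<in> carrier M" using y x N.a_elemrcos_carrier by blast
    have "N +>\<^bsub>M\<^esub> x = N +>\<^bsub>M\<^esub> y"
      using y x N.a_subgroup by (rule M.a_repr_independence)
    then have "y \<ominus>\<^bsub>M\<^esub> x \<in> N" using submodule_coset_eq_iff[OF N yM x] by simp
    then have "a \<odot>\<^bsub>M\<^esub> (y \<ominus>\<^bsub>M\<^esub> x) \<in> N" using submoduleE(4)[OF N a] by blast
    then show ?thesis using submodule_coset_eq_iff[OF N] a x yM
      by (simp add: M.minus_eq smult_r_distr smult_r_minus)
  qed
  \<comment> \<open>An empty union would be the empty set, so the coset has to be seen to be
    inhabited.\<close>
  moreover have "N +>\<^bsub>M\<^esub> x \<noteq> {}" using N.a_rcos_self[OF x] by blast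
  ultimately have "(\<Union>y\<in>N +>\<^bsub>M\<^esub> x. N +>\<^bsub>M\<^esub> (a \<odot>\<^bsub>M\<^esub> y)) = N +>\<^bsub>M\<^esub> (a \<odot>\<^bsub>M\<^esub> x)"
    by (intro SUP_eq_const)
  then show ?thesis by (simp add: quot_module_def)
qed

lemma quot_module_add:
  assumes N: "submodule N R M" and "x \<in> carrier M" "y \<in> carrier M"
  shows "(N +>\<^bsub>M\<^esub> x) \<oplus>\<^bsub>quot_module M N\<^esub> (N +>\<^bsub>M\<^esub> y) = N +>\<^bsub>M\<^esub> (x \<oplus>\<^bsub>M\<^esub> y)"
  using abelian_subgroup.a_rcos_sum[OF submodule_abelian_subgroup[OF N]] assms
  by (simp add: quot_module_def)

lemma carrier_quot_module: "carrier (quot_module M N) = (\<lambda>x. N +>\<^bsub>M\<^esub> x) ` carrier M"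
  by (auto simp: quot_module_def A_RCOSETS_def')

lemma zero_quot_module:
  assumes "submodule N R M"
  shows "\<zero>\<^bsub>quot_module M N\<^esub> = N +>\<^bsub>M\<^esub> \<zero>\<^bsub>M\<^esub>"
  using submoduleE(1)[OF assms] by (simp add: quot_module_def)

text \<open>Every axiom is pulled back to representatives in \<open>M\<close>, where it holds
  because \<open>M\<close> is a module.\<close>

lemma module_quot_module:
  assumes N: "submodule N R M"
  shows "module R (quot_module M N)"
proof (rule moduleI)
  let ?Q = "quot_module M N" and ?q = "\<lambda>x. N +>\<^bsub>M\<^esub> x"
  note add = quot_module_add[OF N] and smult = quot_module_smult[OF N]
  have rep: "\<exists>u\<in>carrier M. x = ?q u" if "x \<in> carrier ?Q" for x
    using that by (auto simp: carrier_quot_module)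
  have q: "?q x \<in> carrier ?Q" if "x \<in> carrier M" for x
    using that by (simp add: carrier_quot_module)
  show "cring R" by (rule R.is_cring)
  show "abelian_group ?Q"
  proof (rule abelian_groupI)
    fix x y z assume xyz: "x \<in> carrier ?Q" "y \<in> carrier ?Q" "z \<in> carrier ?Q"
    obtain u v w where u: "u \<in> carrier M" "v \<in> carrier M" "w \<in> carrier M"
      and eq: "x = ?q u" "y = ?q v" "z = ?q w"
      using rep[OF xyz(1)] rep[OF xyz(2)] rep[OF xyz(3)] by blast
    show "x \<oplus>\<^bsub>?Q\<^esub> y \<oplus>\<^bsub>?Q\<^esub> z = x \<oplus>\<^bsub>?Q\<^esub> (y \<oplus>\<^bsub>?Q\<^esub> z)"
      using u by (simp add: eq add M.a_assoc)
  next
    fix x y assume xyz: "x \<in> carrier ?Q" "y \<in> carrier ?Q"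
    obtain u v where u: "u \<in> carrier M" "v \<in> carrier M" and eq: "x = ?q u" "y = ?q v"
      using rep[OF xyz(1)] rep[OF xyz(2)] by blast
    show "x \<oplus>\<^bsub>?Q\<^esub> y = y \<oplus>\<^bsub>?Q\<^esub> x" using u by (simp add: eq add M.a_comm)
    show "x \<oplus>\<^bsub>?Q\<^esub> y \<in> carrier ?Q" using u by (simp add: eq add q)
  next
    fix x assume x: "x \<in> carrier ?Q"
    obtain u where u: "u \<in> carrier M" and eq: "x = ?q u" using rep[OF x] by blast
    show "\<zero>\<^bsub>?Q\<^esub> \<oplus>\<^bsub>?Q\<^esub> x = x" using u by (simp add: eq add zero_quot_module[OF N])
    show "\<exists>y\<in>carrier ?Q. y \<oplus>\<^bsub>?Q\<^esub> x = \<zero>\<^bsub>?Q\<^esub>"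
      using u by (intro bexI[of _ "?q (\<ominus>\<^bsub>M\<^esub> u)"])
        (simp_all add: eq add zero_quot_module[OF N] M.l_neg q)
  qed (simp add: zero_quot_module[OF N] q)
next
  let ?Q = "quot_module M N" and ?q = "\<lambda>x. N +>\<^bsub>M\<^esub> x"
  note add = quot_module_add[OF N] and smult = quot_module_smult[OF N]
  fix x assume x: "x \<in> carrier ?Q"
  obtain u where u: "u \<in> carrier M" and eq: "x = ?q u"
    using x by (auto simp: carrier_quot_module)
  show "\<one> \<odot>\<^bsub>?Q\<^esub> x = x" using u by (simp add: eq smult)
  fix a assume a: "a \<in> carrier R"
  show "a \<odot>\<^bsub>?Q\<^esub> x \<in> carrier ?Q" using u a by (simp add: eq smult carrier_quot_module)
  show "(a \<oplus> b) \<odot>\<^bsub>?Q\<^esub> x = a \<odot>\<^bsub>?Q\<^esub> x \<oplus>\<^bsub>?Q\<^esub> b \<odot>\<^bsub>?Q\<^esub> x" if "b \<in> carrier R" for b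
    using u a that by (simp add: eq smult add smult_l_distr)
  show "(a \<otimes> b) \<odot>\<^bsub>?Q\<^esub> x = a \<odot>\<^bsub>?Q\<^esub> (b \<odot>\<^bsub>?Q\<^esub> x)" if "b \<in> carrier R" for b
    using u a that by (simp add: eq smult smult_assoc1)
  show "a \<odot>\<^bsub>?Q\<^esub> (x \<oplus>\<^bsub>?Q\<^esub> y) = a \<odot>\<^bsub>?Q\<^esub> x \<oplus>\<^bsub>?Q\<^esub> a \<odot>\<^bsub>?Q\<^esub> y" if y: "y \<in> carrier ?Q" for y
  proof -
    obtain v where v: "v \<in> carrier M" "y = ?q v" using y by (auto simp: carrier_quot_module)
    then show ?thesis using u a by (simp add: eq smult add smult_r_distr)
  qed
qed

end

section \<open>Free modules\<close>

context cring
begin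

lemma free_module_carrierD:
  assumes "\<phi> \<in> carrier (free_module R S)"
  shows "\<phi> s \<in> carrier R" "finite {s. \<phi> s \<noteq> \<zero>}" "\<phi> s \<noteq> \<zero> \<Longrightarrow> s \<in> S"
  using assms by (auto simp: free_module_def)

lemma free_module_carrierI:
  assumes "\<And>s. \<phi> s \<in> carrier R" "finite {s. \<phi> s \<noteq> \<zero>}" "\<And>s. \<phi> s \<noteq> \<zero> \<Longrightarrow> s \<in> S"
  shows "\<phi> \<in> carrier (free_module R S)"
  using assms by (auto simp: free_module_def)

lemma free_module_simps:
  "\<zero>\<^bsub>free_module R S\<^esub> = (\<lambda>_. \<zero>)"
  "\<phi> \<oplus>\<^bsub>free_module R S\<^esub> \<psi> = (\<lambda>s. \<phi> s \<oplus> \<psi> s)"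
  "a \<odot>\<^bsub>free_module R S\<^esub> \<phi> = (\<lambda>s. a \<otimes> \<phi> s)"
  by (simp_all add: free_module_def)

lemma module_free_module: "module R (free_module R S)"
proof (rule moduleI)
  let ?F = "free_module R S"
  note D = free_module_carrierD[where S = S]
  show "abelian_group ?F"
  proof (rule abelian_groupI)
    show "x \<oplus>\<^bsub>?F\<^esub> y \<in> carrier ?F" if x: "x \<in> carrier ?F" and y: "y \<in> carrier ?F" for x y
      unfolding free_module_simps
    proof (rule free_module_carrierI)
      show "finite {s. x s \<oplus> y s \<noteq> \<zero>}"
        by (rule finite_subset[OF _ finite_UnI[OF D(2)[OF x] D(2)[OF y]]]) auto
      show "s \<in> S" if "x s \<oplus> y s \<noteq> \<zero>" for s
        using that D(3)[OF x, of s] D(3)[OF y, of s] by (metis r_zero zero_closed)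
    qed (use D(1)[OF x] D(1)[OF y] in simp)
    show "\<exists>y\<in>carrier ?F. y \<oplus>\<^bsub>?F\<^esub> x = \<zero>\<^bsub>?F\<^esub>" if x: "x \<in> carrier ?F" for x
    proof (rule bexI)
      show "(\<lambda>s. \<ominus> x s) \<oplus>\<^bsub>?F\<^esub> x = \<zero>\<^bsub>?F\<^esub>"
        using D(1)[OF x] by (simp add: free_module_simps l_neg)
      have "\<ominus> x s = \<zero> \<longleftrightarrow> x s = \<zero>" for s
        using D(1)[OF x, of s] by (metis minus_minus minus_zero)
      then show "(\<lambda>s. \<ominus> x s) \<in> carrier ?F"
        using D[OF x] by (intro free_module_carrierI) auto
    qed
    show "\<zero>\<^bsub>?F\<^esub> \<in> carrier ?F"
      unfolding free_module_simps by (rule free_module_carrierI) auto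
    show "x \<oplus>\<^bsub>?F\<^esub> y \<oplus>\<^bsub>?F\<^esub> z = x \<oplus>\<^bsub>?F\<^esub> (y \<oplus>\<^bsub>?F\<^esub> z)"
      if "x \<in> carrier ?F" "y \<in> carrier ?F" "z \<in> carrier ?F" for x y z
      using that[THEN D(1)] by (simp add: free_module_simps a_assoc)
    show "x \<oplus>\<^bsub>?F\<^esub> y = y \<oplus>\<^bsub>?F\<^esub> x" if "x \<in> carrier ?F" "y \<in> carrier ?F" for x y
      using that[THEN D(1)] by (simp add: free_module_simps a_comm)
    show "\<zero>\<^bsub>?F\<^esub> \<oplus>\<^bsub>?F\<^esub> x = x" if "x \<in> carrier ?F" for x
      using that[THEN D(1)] by (simp add: free_module_simps)
  qed
  show "a \<odot>\<^bsub>?F\<^esub> x \<in> carrier ?F" if a: "a \<in> carrier R" and x: "x \<in> carrier ?F" for a x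
    unfolding free_module_simps
  proof (rule free_module_carrierI)
    show "finite {s. a \<otimes> x s \<noteq> \<zero>}"
      by (rule finite_subset[OF _ D(2)[OF x]]) (use a in auto)
    show "s \<in> S" if "a \<otimes> x s \<noteq> \<zero>" for s
      using that a D(3)[OF x, of s] by (metis r_null)
  qed (use a D(1)[OF x] in simp)
  show "(a \<oplus> b) \<odot>\<^bsub>?F\<^esub> x = a \<odot>\<^bsub>?F\<^esub> x \<oplus>\<^bsub>?F\<^esub> b \<odot>\<^bsub>?F\<^esub> x"
    if "a \<in> carrier R" "b \<in> carrier R" "x \<in> carrier ?F" for a b x
    using that(1,2) that(3)[THEN D(1)] by (simp add: free_module_simps l_distr)
  show "a \<odot>\<^bsub>?F\<^esub> (x \<oplus>\<^bsub>?F\<^esub> y) = a \<odot>\<^bsub>?F\<^esub> x \<oplus>\<^bsub>?F\<^esub> a \<odot>\<^bsub>?F\<^esub> y"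
    if "a \<in> carrier R" "x \<in> carrier ?F" "y \<in> carrier ?F" for a x y
    using that(1) that(2,3)[THEN D(1)] by (simp add: free_module_simps r_distr)
  show "(a \<otimes> b) \<odot>\<^bsub>?F\<^esub> x = a \<odot>\<^bsub>?F\<^esub> (b \<odot>\<^bsub>?F\<^esub> x)"
    if "a \<in> carrier R" "b \<in> carrier R" "x \<in> carrier ?F" for a b x
    using that(1,2) that(3)[THEN D(1)] by (simp add: free_module_simps m_assoc)
  show "\<one> \<odot>\<^bsub>?F\<^esub> x = x" if "x \<in> carrier ?F" for x
    using that[THEN D(1)] by (simp add: free_module_simps)
qed (rule is_cring)

lemma free_basis_carrier: "s \<in> S \<Longrightarrow> free_basis R s \<in> carrier (free_module R S)"
  by (auto simp: free_module_def free_basis_def)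

text \<open>Induction on a finite set containing the support: splitting off the coordinate
  \<open>b\<close> writes \<open>\<phi>\<close> as a multiple of the basis vector at
  \<open>b\<close> plus \<open>\<phi>(b := \<zero>)\<close>, whose support lies in the smaller
  set.\<close>

lemma free_module_submodule_eq:
  assumes T: "submodule T R (free_module R S)" and e: "\<And>s. s \<in> S \<Longrightarrow> free_basis R s \<in> T"
    and \<phi>: "\<phi> \<in> carrier (free_module R S)"
  shows "\<phi> \<in> T"
proof -
  let ?F = "free_module R S"
  interpret F: module R ?F by (rule module_free_module)
  have "\<phi> \<in> T" if "finite B" "\<phi> \<in> carrier ?F" "{s. \<phi> s \<noteq> \<zero>} \<subseteq> B" for B \<phi>
    using that
  proof (induction B arbitrary: \<phi>)
    case empty
    then have "\<phi> = \<zero>\<^bsub>?F\<^esub>" by (auto simp: free_module_def)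
    then show ?case using F.submodule_zero[OF T] by simp
  next
    case (insert b B)
    have rng: "\<phi> s \<in> carrier R" for s using insert.prems by (auto simp: free_module_def)
    let ?\<psi> = "\<phi>(b := \<zero>)"
    have sub: "{s. ?\<psi> s \<noteq> \<zero>} \<subseteq> {s. \<phi> s \<noteq> \<zero>}" by auto
    have "finite {s. ?\<psi> s \<noteq> \<zero>}"
      using finite_subset[OF sub] insert.prems by (auto simp: free_module_def)
    then have \<psi>: "?\<psi> \<in> carrier ?F" using insert.prems sub
      by (auto simp: free_module_def)
    have "?\<psi> \<in> T" by (rule insert.IH[OF \<psi>]) (use insert.prems in auto)
    \<comment> \<open>The bound \<open>insert b B\<close> on the support need not lie in
      \<open>S\<close>; only a non-zero value at \<open>b\<close> forces
      \<open>b \<in> S\<close>.\<close>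
    moreover have "\<phi> b \<odot>\<^bsub>?F\<^esub> free_basis R b \<in> T" if "\<phi> b \<noteq> \<zero>"
      using that insert.prems e rng F.submoduleE(4)[OF T] by (auto simp: free_module_def)
    moreover have "\<phi> = (\<phi> b \<odot>\<^bsub>?F\<^esub> free_basis R b) \<oplus>\<^bsub>?F\<^esub> ?\<psi>"
      using rng by (auto simp: free_module_def free_basis_def fun_eq_iff)
    moreover have "\<phi> = ?\<psi>" if "\<phi> b = \<zero>" using that by auto
    ultimately show ?case using F.submoduleE(5)[OF T] by metis
  qed
  then show ?thesis using \<phi> by (auto simp: free_module_def)
qed

end

lemma (in abelian_group) add_diff_rearrange:
  assumes "a \<in> carrier G" "b \<in> carrier G" "c \<in> carrier G" "d \<in> carrier G"
  shows "(a \<oplus> b) \<ominus> (c \<oplus> d) = (a \<ominus> c) \<oplus> (b \<ominus> d)"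
  using assms by (simp add: a_minus_def minus_add a_ac)

section \<open>Linear maps into the base ring and the submodules and ideals they define\<close>

context module
begin

text \<open>The values at zero, negatives and differences come from linearity with the scalars
  \<open>\<zero>\<close> and \<open>\<ominus> \<one>\<close>.\<close>

lemma linear_mapD:
  assumes "linear_map R M h"
  shows "u \<in> carrier M \<Longrightarrow> h u \<in> carrier R"
    "u \<in> carrier M \<Longrightarrow> v \<in> carrier M \<Longrightarrow> h (u \<oplus>\<^bsub>M\<^esub> v) = h u \<oplus> h v"
    "a \<in> carrier R \<Longrightarrow> u \<in> carrier M \<Longrightarrow> h (a \<odot>\<^bsub>M\<^esub> u) = a \<otimes> h u"
    "h \<zero>\<^bsub>M\<^esub> = \<zero>" "u \<in> carrier M \<Longrightarrow> h (\<ominus>\<^bsub>M\<^esub> u) = \<ominus> h u"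
    "u \<in> carrier M \<Longrightarrow> v \<in> carrier M \<Longrightarrow> h (u \<ominus>\<^bsub>M\<^esub> v) = h u \<ominus> h v"
proof -
  show h: "u \<in> carrier M \<Longrightarrow> h u \<in> carrier R" for u
    using assms by (auto simp: linear_map_def)
  show add: "u \<in> carrier M \<Longrightarrow> v \<in> carrier M \<Longrightarrow> h (u \<oplus>\<^bsub>M\<^esub> v) = h u \<oplus> h v" for u v
    using assms by (simp add: linear_map_def)
  show smult: "a \<in> carrier R \<Longrightarrow> u \<in> carrier M \<Longrightarrow> h (a \<odot>\<^bsub>M\<^esub> u) = a \<otimes> h u" for a u
    using assms by (simp add: linear_map_def)
  show "h \<zero>\<^bsub>M\<^esub> = \<zero>"
    using smult[of \<zero> "\<zero>\<^bsub>M\<^esub>"] h[of "\<zero>\<^bsub>M\<^esub>"] by simp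
  have minus: "h (\<ominus>\<^bsub>M\<^esub> u) = \<ominus> h u" if u: "u \<in> carrier M" for u
  proof -
    have "\<ominus>\<^bsub>M\<^esub> u = (\<ominus> \<one>) \<odot>\<^bsub>M\<^esub> u" using u by (simp add: smult_l_minus)
    then show ?thesis using smult[of "\<ominus> \<one>" u] h[OF u] u by (simp add: R.l_minus)
  qed
  then show "u \<in> carrier M \<Longrightarrow> h (\<ominus>\<^bsub>M\<^esub> u) = \<ominus> h u" .
  show "u \<in> carrier M \<Longrightarrow> v \<in> carrier M \<Longrightarrow> h (u \<ominus>\<^bsub>M\<^esub> v) = h u \<ominus> h v"
    by (simp add: a_minus_def add minus)
qed

text \<open>Reduces the claim that \<open>h\<close> maps into \<open>J\<close> to generators. It is
  used with \<open>J\<close> the ideal of the variables and with the zero ideal.\<close>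

lemma submodule_linear_preimage:
  assumes h: "linear_map R M h" and J: "ideal J R"
  shows "submodule {w \<in> carrier M. h w \<in> J} R M"
proof -
  interpret J: ideal J R by (rule J)
  show ?thesis
    by (rule submoduleI) (auto simp: linear_mapD[OF h] J.zero_closed J.a_inv_closed J.a_closed J.I_l_closed)
qed

text \<open>Linear maps that agree on generators agree everywhere; this is how the Euler form is
  seen to be unique.\<close>

lemma submodule_linear_equalizer:
  assumes h: "linear_map R M h" and g: "linear_map R M g"
  shows "submodule {w \<in> carrier M. h w = g w} R M"
  by (rule submoduleI) (auto simp: linear_mapD[OF h] linear_mapD[OF g])

text \<open>Being an ideal, the image contains the ideal generated by any of its subsets; this
  yields surjectivity of the Euler form onto the ideal of the variables.\<close>

lemma ideal_linear_image:
  assumes h: "linear_map R M h"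
  shows "ideal (h ` carrier M) R"
proof (rule idealI[OF R.ring_axioms])
  show "subgroup (h ` carrier M) (add_monoid R)"
  proof (rule R.add.subgroupI)
    show "h ` carrier M \<subseteq> carrier R" using linear_mapD(1)[OF h] by blast
    show "h ` carrier M \<noteq> {}" using M.zero_closed by blast
    show "\<ominus> a \<in> h ` carrier M" if a: "a \<in> h ` carrier M" for a
    proof -
      obtain u where "u \<in> carrier M" "a = h u" using a by blast
      then show ?thesis using linear_mapD(5)[OF h, of u] by (metis M.a_inv_closed imageI)
    qed
    show "a \<oplus> b \<in> h ` carrier M" if ab: "a \<in> h ` carrier M" "b \<in> h ` carrier M" for a b
    proof -
      obtain u v where "u \<in> carrier M" "a = h u" "v \<in> carrier M" "b = h v" using ab by blast
      then show ?thesis using linear_mapD(2)[OF h, of u v] by (metis M.a_closed imageI)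
    qed
  qed
  have l: "r \<otimes> a \<in> h ` carrier M" if a: "a \<in> h ` carrier M" and r: "r \<in> carrier R" for a r
  proof -
    obtain u where "u \<in> carrier M" "a = h u" using a by blast
    then show ?thesis using linear_mapD(3)[OF h r, of u] smult_closed[OF r] by (metis imageI)
  qed
  then show "r \<otimes> a \<in> h ` carrier M" if "a \<in> h ` carrier M" "r \<in> carrier R" for a r
    using that by blast
  show "a \<otimes> r \<in> h ` carrier M" if a: "a \<in> h ` carrier M" and r: "r \<in> carrier R" for a r
  proof -
    have "a \<in> carrier R" using a linear_mapD(1)[OF h] by blast
    then show ?thesis using l[OF a r] r by (simp add: R.m_comm)
  qed
qed

end

section \<open>Kaehler differentials and their universal property\<close>

locale kaehler_ring = cring R for R (structure) +
  fixes A :: "'a set"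
  assumes A_carrier: "A \<subseteq> carrier R"
begin

abbreviation "F \<equiv> free_module R (carrier R)"
abbreviation "N \<equiv> kaehler_kernel R A"
abbreviation "\<Omega> \<equiv> kaehler R A"
abbreviation "d \<equiv> kaehler_d R A"
abbreviation "e \<equiv> free_basis R"

sublocale F: module R F by (rule module_free_module)

lemma e_closed [simp, intro]: "r \<in> carrier R \<Longrightarrow> e r \<in> carrier F"
  by (rule free_basis_carrier)

lemma kaehler_relations_carrier: "kaehler_relations R A \<subseteq> carrier F"
  using A_carrier by (auto simp: kaehler_relations_def Let_def)

lemma N_submodule: "submodule N R F"
  unfolding kaehler_kernel_def by (rule F.submod_gen_submodule[OF kaehler_relations_carrier])

lemma relation_in_N: "\<phi> \<in> kaehler_relations R A \<Longrightarrow> \<phi> \<in> N"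
  unfolding kaehler_kernel_def by (rule subsetD[OF submod_gen_incl])

sublocale \<Omega>: module R \<Omega>
  unfolding kaehler_def by (rule F.module_quot_module[OF N_submodule])

lemma d_closed [simp, intro]: "r \<in> carrier R \<Longrightarrow> d r \<in> carrier \<Omega>"
  by (auto simp: kaehler_d_def kaehler_def F.carrier_quot_module)

lemma d_add:
  assumes "r \<in> carrier R" "s \<in> carrier R"
  shows "d (r \<oplus> s) = d r \<oplus>\<^bsub>\<Omega>\<^esub> d s"
proof -
  have "e (r \<oplus> s) \<ominus>\<^bsub>F\<^esub> (e r \<oplus>\<^bsub>F\<^esub> e s) \<in> N"
    by (rule relation_in_N) (use assms in \<open>auto simp: kaehler_relations_def Let_def\<close>)
  then have "N +>\<^bsub>F\<^esub> e (r \<oplus> s) = N +>\<^bsub>F\<^esub> (e r \<oplus>\<^bsub>F\<^esub> e s)"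
    using assms by (subst F.submodule_coset_eq_iff[OF N_submodule]) auto
  then show ?thesis using assms
    by (simp add: kaehler_d_def kaehler_def F.quot_module_add[OF N_submodule])
qed

lemma d_mult:
  assumes "r \<in> carrier R" "s \<in> carrier R"
  shows "d (r \<otimes> s) = (r \<odot>\<^bsub>\<Omega>\<^esub> d s) \<oplus>\<^bsub>\<Omega>\<^esub> (s \<odot>\<^bsub>\<Omega>\<^esub> d r)"
proof -
  have "e (r \<otimes> s) \<ominus>\<^bsub>F\<^esub> (r \<odot>\<^bsub>F\<^esub> e s \<oplus>\<^bsub>F\<^esub> s \<odot>\<^bsub>F\<^esub> e r) \<in> N"
    by (rule relation_in_N) (use assms in \<open>auto simp: kaehler_relations_def Let_def\<close>)
  then have "N +>\<^bsub>F\<^esub> e (r \<otimes> s) = N +>\<^bsub>F\<^esub> (r \<odot>\<^bsub>F\<^esub> e s \<oplus>\<^bsub>F\<^esub> s \<odot>\<^bsub>F\<^esub> e r)"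
    using assms by (subst F.submodule_coset_eq_iff[OF N_submodule]) auto
  then show ?thesis using assms
    by (simp add: kaehler_d_def kaehler_def F.quot_module_add[OF N_submodule]
        F.quot_module_smult[OF N_submodule])
qed

lemma d_const:
  assumes "a \<in> A" shows "d a = \<zero>\<^bsub>\<Omega>\<^esub>"
proof -
  have a: "a \<in> carrier R" using assms A_carrier by auto
  have "e a \<in> N"
    by (rule relation_in_N) (use assms in \<open>auto simp: kaehler_relations_def Let_def\<close>)
  then show ?thesis
    using F.M.a_coset_join2[OF e_closed[OF a] submodule.axioms(1)[OF N_submodule]]
    by (simp add: kaehler_d_def kaehler_def quot_module_def)
qed

lemma d_zero: "d \<zero> = \<zero>\<^bsub>\<Omega>\<^esub>"
  using d_add[of \<zero> \<zero>] by (simp add: \<Omega>.M.add.r_cancel_one')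

text \<open>The preimage of \<open>T\<close> under the projection from the free module is a
  submodule containing every basis element, hence the whole free module.\<close>

lemma kaehler_generated:
  assumes T: "submodule T R \<Omega>" and d: "\<And>r. r \<in> carrier R \<Longrightarrow> d r \<in> T"
    and w: "w \<in> carrier \<Omega>"
  shows "w \<in> T"
proof -
  let ?q = "\<lambda>\<phi>. N +>\<^bsub>F\<^esub> \<phi>"
  have q_add: "?q (x \<oplus>\<^bsub>F\<^esub> y) = ?q x \<oplus>\<^bsub>\<Omega>\<^esub> ?q y" if "x \<in> carrier F" "y \<in> carrier F" for x y
    using that by (simp add: kaehler_def F.quot_module_add[OF N_submodule])
  have q_smult: "?q (a \<odot>\<^bsub>F\<^esub> x) = a \<odot>\<^bsub>\<Omega>\<^esub> ?q x" if "a \<in> carrier R" "x \<in> carrier F" for a x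
    using that by (simp add: kaehler_def F.quot_module_smult[OF N_submodule])
  have q_zero: "?q \<zero>\<^bsub>F\<^esub> = \<zero>\<^bsub>\<Omega>\<^esub>" by (simp add: kaehler_def F.zero_quot_module[OF N_submodule])
  have q_closed: "?q x \<in> carrier \<Omega>" if "x \<in> carrier F" for x
    using that by (simp add: kaehler_def F.carrier_quot_module)
  have "submodule {\<phi> \<in> carrier F. ?q \<phi> \<in> T} R F"
  proof (rule F.submoduleI)
    show "\<zero>\<^bsub>F\<^esub> \<in> {\<phi> \<in> carrier F. ?q \<phi> \<in> T}"
      using \<Omega>.submodule_zero[OF T] by (simp add: q_zero)
    have "\<ominus>\<^bsub>F\<^esub> x = (\<ominus> \<one>) \<odot>\<^bsub>F\<^esub> x" if "x \<in> carrier F" for x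
      using that by (simp add: F.smult_l_minus)
    then show "\<ominus>\<^bsub>F\<^esub> a \<in> {\<phi> \<in> carrier F. ?q \<phi> \<in> T}" if "a \<in> {\<phi> \<in> carrier F. ?q \<phi> \<in> T}" for a
      using that \<Omega>.submoduleE(4)[OF T] q_smult[of "\<ominus> \<one>" a] by auto
  qed (use \<Omega>.submoduleE[OF T] in \<open>auto simp: q_add q_smult\<close>)
  then have "\<phi> \<in> {\<phi> \<in> carrier F. ?q \<phi> \<in> T}" if "\<phi> \<in> carrier F" for \<phi>
    by (rule free_module_submodule_eq) (use that d in \<open>auto simp: kaehler_d_def\<close>)
  then show ?thesis using w by (auto simp: kaehler_def F.carrier_quot_module)
qed

text \<open>The universal property: \<open>D\<close> extends linearly to the free module, the
  extension kills the defining relations because \<open>D\<close> is a derivation vanishing on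
  \<open>A\<close>, and so it factors through the quotient.\<close>

lemma kaehler_universal:
  assumes D_closed: "D \<in> carrier R \<rightarrow> carrier R"
    and D_add: "\<And>r s. r \<in> carrier R \<Longrightarrow> s \<in> carrier R \<Longrightarrow> D (r \<oplus> s) = D r \<oplus> D s"
    and D_mult: "\<And>r s. r \<in> carrier R \<Longrightarrow> s \<in> carrier R \<Longrightarrow> D (r \<otimes> s) = r \<otimes> D s \<oplus> s \<otimes> D r"
    and D_const: "\<And>a. a \<in> A \<Longrightarrow> D a = \<zero>"
  obtains h where "linear_map R \<Omega> h" "\<And>r. r \<in> carrier R \<Longrightarrow> h (d r) = D r"
proof -
  \<comment> \<open>\<open>L\<close> is the linear extension of \<open>e s \<mapsto> D s\<close>,
    summed over the support.\<close>
  define L where "L \<phi> = (\<Oplus>s\<in>{s. \<phi> s \<noteq> \<zero>}. \<phi> s \<otimes> D s)" for \<phi> :: "'a \<Rightarrow> 'a"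
  have D [simp]: "D r \<in> carrier R" if "r \<in> carrier R" for r using D_closed that by auto
  have supp: "finite {s. \<phi> s \<noteq> \<zero>}" "{s. \<phi> s \<noteq> \<zero>} \<subseteq> carrier R" "\<And>s. \<phi> s \<in> carrier R"
    if "\<phi> \<in> carrier F" for \<phi>
    using free_module_carrierD[OF that] by auto
  \<comment> \<open>Enlarging the index set adds only zero terms, so sums for different elements can
    be compared over a common finite set.\<close>
  have L_eq: "L \<phi> = (\<Oplus>s\<in>B. \<phi> s \<otimes> D s)"
    if "finite B" "B \<subseteq> carrier R" "{s. \<phi> s \<noteq> \<zero>} \<subseteq> B" "\<phi> \<in> carrier F" for \<phi> B
    unfolding L_def using that supp(3)[OF that(4)]
    by (intro add.finprod_mono_neutral_cong_left) auto
  have L_closed: "L \<phi> \<in> carrier R" if "\<phi> \<in> carrier F" for \<phi>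
    unfolding L_def using supp[OF that] by (intro finsum_closed) auto
  have L_add: "L (\<phi> \<oplus>\<^bsub>F\<^esub> \<psi>) = L \<phi> \<oplus> L \<psi>" if \<phi>: "\<phi> \<in> carrier F" and \<psi>: "\<psi> \<in> carrier F" for \<phi> \<psi>
  proof -
    let ?B = "{s. \<phi> s \<noteq> \<zero>} \<union> {s. \<psi> s \<noteq> \<zero>}"
    have B: "finite ?B" "?B \<subseteq> carrier R" using supp[OF \<phi>] supp[OF \<psi>] by auto
    have sum: "\<phi> \<oplus>\<^bsub>F\<^esub> \<psi> \<in> carrier F" using \<phi> \<psi> by simp
    have "L (\<phi> \<oplus>\<^bsub>F\<^esub> \<psi>) = (\<Oplus>s\<in>?B. (\<phi> \<oplus>\<^bsub>F\<^esub> \<psi>) s \<otimes> D s)"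
      by (rule L_eq[OF B _ sum]) (auto simp: free_module_def)
    also have "\<dots> = (\<Oplus>s\<in>?B. \<phi> s \<otimes> D s \<oplus> \<psi> s \<otimes> D s)"
      using B supp[OF \<phi>] supp[OF \<psi>] by (intro finsum_cong') (auto simp: free_module_def l_distr)
    also have "\<dots> = (\<Oplus>s\<in>?B. \<phi> s \<otimes> D s) \<oplus> (\<Oplus>s\<in>?B. \<psi> s \<otimes> D s)"
      using B supp[OF \<phi>] supp[OF \<psi>] by (intro finsum_addf) auto
    also have "\<dots> = L \<phi> \<oplus> L \<psi>"
      using L_eq[OF B _ \<phi>] L_eq[OF B _ \<psi>] by auto
    finally show ?thesis .
  qed
  have L_smult: "L (a \<odot>\<^bsub>F\<^esub> \<phi>) = a \<otimes> L \<phi>" if \<phi>: "\<phi> \<in> carrier F" and a: "a \<in> carrier R" for a \<phi>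
  proof -
    let ?B = "{s. \<phi> s \<noteq> \<zero>}"
    have "L (a \<odot>\<^bsub>F\<^esub> \<phi>) = (\<Oplus>s\<in>?B. (a \<odot>\<^bsub>F\<^esub> \<phi>) s \<otimes> D s)"
      using supp[OF \<phi>] a by (intro L_eq F.smult_closed \<phi>) (auto simp: free_module_simps)
    also have "\<dots> = (\<Oplus>s\<in>?B. a \<otimes> (\<phi> s \<otimes> D s))"
      using supp[OF \<phi>] a by (intro finsum_cong') (auto simp: free_module_def m_assoc)
    also have "\<dots> = a \<otimes> L \<phi>"
      unfolding L_def using supp[OF \<phi>] a by (intro finsum_rdistr[symmetric]) auto
    finally show ?thesis .
  qed
  have L_e: "L (e r) = D r" if r: "r \<in> carrier R" for r
  proof -
    have "L (e r) = (\<Oplus>s\<in>{r}. e r s \<otimes> D s)"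
      using r by (intro L_eq e_closed) (auto simp: free_basis_def)
    also have "\<dots> = D r" using r by (simp add: free_basis_def)
    finally show ?thesis .
  qed
  have minus: "\<ominus>\<^bsub>F\<^esub> x = (\<ominus> \<one>) \<odot>\<^bsub>F\<^esub> x" if "x \<in> carrier F" for x
    using that by (simp add: F.smult_l_minus)
  have L_minus: "L (\<phi> \<ominus>\<^bsub>F\<^esub> \<psi>) = L \<phi> \<ominus> L \<psi>" if \<phi>: "\<phi> \<in> carrier F" and \<psi>: "\<psi> \<in> carrier F" for \<phi> \<psi>
    using \<phi> \<psi> L_closed
    by (simp add: F.M.minus_eq L_add minus L_smult minus_eq l_minus)
  let ?Z = "{\<phi> \<in> carrier F. L \<phi> = \<zero>}"
  have "submodule ?Z R F"
  proof (rule F.submoduleI)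
    show "\<zero>\<^bsub>F\<^esub> \<in> ?Z" by (simp add: L_def free_module_def)
    show "\<ominus>\<^bsub>F\<^esub> x \<in> ?Z" if "x \<in> ?Z" for x
      using that by (simp add: minus L_smult)
  qed (auto simp: L_add L_smult)
  moreover have "kaehler_relations R A \<subseteq> ?Z"
    using kaehler_relations_carrier A_carrier
    by (auto simp: kaehler_relations_def Let_def L_minus L_add L_smult L_e D_add D_mult D_const)
  ultimately have N: "N \<subseteq> ?Z" unfolding kaehler_kernel_def by (intro submod_gen_minimal)
  \<comment> \<open>A coset is a set of elements of the free module on which \<open>L\<close> is
    constant, so its image is a singleton and \<open>the_elem\<close> extracts the value.\<close>
  define h where "h X = the_elem (L ` X)" for X
  have h: "h (N +>\<^bsub>F\<^esub> \<phi>) = L \<phi>" if \<phi>: "\<phi> \<in> carrier F" for \<phi>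
  proof -
    interpret N: abelian_subgroup N F by (rule F.submodule_abelian_subgroup[OF N_submodule])
    have "L \<psi> = L \<phi>" if \<psi>: "\<psi> \<in> N +>\<^bsub>F\<^esub> \<phi>" for \<psi>
    proof -
      obtain \<nu> where \<nu>: "\<nu> \<in> N" "\<psi> = \<nu> \<oplus>\<^bsub>F\<^esub> \<phi>" using \<psi> by (auto simp: a_r_coset_def')
      then have "\<nu> \<in> carrier F" "L \<nu> = \<zero>" using N by auto
      then show ?thesis using \<nu> \<phi> by (simp add: L_add L_closed)
    qed
    moreover have "N +>\<^bsub>F\<^esub> \<phi> \<noteq> {}" using N.a_rcos_self[OF \<phi>] by blast
    ultimately show ?thesis unfolding h_def by (intro the_elem_image_unique)
  qed
  show ?thesis
  proof
    show "linear_map R \<Omega> h"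
      unfolding linear_map_def kaehler_def F.carrier_quot_module
      by (auto simp: h L_closed L_add L_smult F.quot_module_add[OF N_submodule]
          F.quot_module_smult[OF N_submodule])
    show "h (d r) = D r" if "r \<in> carrier R" for r
      using that by (simp add: kaehler_d_def h L_e)
  qed
qed

end

section \<open>Homogeneous ideals of the polynomial ring\<close>

lemma pring_simps [simp]:
  "f \<otimes>\<^bsub>pring n\<^esub> g = f * g" "f \<oplus>\<^bsub>pring n\<^esub> g = f + g" "\<one>\<^bsub>pring n\<^esub> = 1" "\<zero>\<^bsub>pring n\<^esub> = 0"
  by (simp_all add: pring_def)

abbreviation pcarrier :: "nat \<Rightarrow> 'k::field mpoly set" where
  "pcarrier n \<equiv> carrier (pring n)"

lemma pcarrier_iff: "f \<in> pcarrier n \<longleftrightarrow> (\<forall>m\<in>Poly_Mapping.keys f. Poly_Mapping.keys m \<subseteq> {..n})"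
  by (simp add: pring_def)

lemma keys_plus_nat: "Poly_Mapping.keys (a + b) = Poly_Mapping.keys a \<union> Poly_Mapping.keys b"
  for a b :: "'a \<Rightarrow>\<^sub>0 nat"
  by (auto simp: in_keys_iff lookup_add)

lemma keys_multE:
  fixes f g :: "'a::monoid_add \<Rightarrow>\<^sub>0 'b::semiring_0"
  assumes "m \<in> Poly_Mapping.keys (f * g)"
  obtains a b where "a \<in> Poly_Mapping.keys f" "b \<in> Poly_Mapping.keys g" "m = a + b"
  using assms keys_mult[of f g] by blast

lemma pcarrier_closed [simp, intro]:
  fixes f g :: "'k::field mpoly"
  shows "0 \<in> pcarrier n" "1 \<in> pcarrier n"
    "f \<in> pcarrier n \<Longrightarrow> g \<in> pcarrier n \<Longrightarrow> f + g \<in> pcarrier n"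
    "f \<in> pcarrier n \<Longrightarrow> g \<in> pcarrier n \<Longrightarrow> f * g \<in> pcarrier n"
    "f \<in> pcarrier n \<Longrightarrow> - f \<in> pcarrier n"
    "pconst c \<in> pcarrier n"
    "j \<le> n \<Longrightarrow> pvar j \<in> pcarrier n"
proof -
  show "f + g \<in> pcarrier n" if "f \<in> pcarrier n" "g \<in> pcarrier n"
    using that keys_add[of f g] unfolding pcarrier_iff by blast
  show "f * g \<in> pcarrier n" if "f \<in> pcarrier n" "g \<in> pcarrier n"
    unfolding pcarrier_iff
  proof
    fix m assume "m \<in> Poly_Mapping.keys (f * g)"
    then obtain a b where "a \<in> Poly_Mapping.keys f" "b \<in> Poly_Mapping.keys g" "m = a + b"
      by (rule keys_multE)
    then show "Poly_Mapping.keys m \<subseteq> {..n}" using that by (auto simp: pcarrier_iff keys_plus_nat)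
  qed
qed (auto simp: pcarrier_iff pconst_def pvar_def)

lemma pcarrier_power [simp, intro]: "f \<in> pcarrier n \<Longrightarrow> f ^ k \<in> pcarrier n"
  by (induction k) auto

lemma pcarrier_sum: "(\<And>i. i \<in> A \<Longrightarrow> f i \<in> pcarrier n) \<Longrightarrow> sum f A \<in> pcarrier n"
  by (induction A rule: infinite_finite_induct) auto

lemma cring_pring: "cring (pring n :: 'k::field mpoly ring)"
proof (rule cringI)
  show "abelian_group (pring n :: 'k mpoly ring)"
  proof (rule abelian_groupI)
    show "\<exists>y\<in>pcarrier n. y \<oplus>\<^bsub>pring n\<^esub> x = \<zero>\<^bsub>pring n\<^esub>" if "x \<in> pcarrier n" for x :: "'k mpoly"
      using that by (intro bexI[of _ "- x"]) auto
  qed (auto simp: algebra_simps)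
  show "comm_monoid (pring n :: 'k mpoly ring)"
    by (rule comm_monoidI) (auto simp: algebra_simps)
qed (auto simp: algebra_simps)

text \<open>Closure under negatives comes from multiplication by \<open>- 1\<close>, and closure
  under right multiples from commutativity.\<close>

lemma ideal_pring_iff:
  fixes I :: "'k::field mpoly set"
  shows "ideal I (pring n) \<longleftrightarrow> I \<subseteq> pcarrier n \<and> 0 \<in> I \<and> (\<forall>a\<in>I. \<forall>b\<in>I. a + b \<in> I) \<and>
     (\<forall>c\<in>pcarrier n. \<forall>a\<in>I. c * a \<in> I)"
proof -
  interpret P: cring "pring n :: 'k::field mpoly ring" by (rule cring_pring)
  show ?thesis
  proof (intro iffI conjI)
    assume "ideal I (pring n)"
    then interpret I: ideal I "pring n" .
    show "I \<subseteq> pcarrier n" by (rule I.a_subset)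
    show "0 \<in> I" using I.zero_closed by simp
    show "\<forall>a\<in>I. \<forall>b\<in>I. a + b \<in> I" using I.a_closed by simp
    show "\<forall>c\<in>pcarrier n. \<forall>a\<in>I. c * a \<in> I" using I.I_l_closed by simp
  next
    assume I: "I \<subseteq> pcarrier n \<and> 0 \<in> I \<and> (\<forall>a\<in>I. \<forall>b\<in>I. a + b \<in> I) \<and>
     (\<forall>c\<in>pcarrier n. \<forall>a\<in>I. c * a \<in> I)"
    show "ideal I (pring n)"
    proof (rule idealI[OF P.ring_axioms])
      show "subgroup I (add_monoid (pring n))"
      proof (rule P.add.subgroupI)
        fix a assume a: "a \<in> I"
        then have "\<ominus>\<^bsub>pring n\<^esub> a = - a" using I by (intro P.minus_equality) auto
        moreover have "(- 1) * a \<in> I" using I a pcarrier_closed(5)[of 1 n] by blast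
        ultimately show "\<ominus>\<^bsub>pring n\<^esub> a \<in> I" by simp
      qed (use I in auto)
      show "a \<otimes>\<^bsub>pring n\<^esub> x \<in> I" if "a \<in> I" "x \<in> pcarrier n" for a x
      proof -
        have "x * a \<in> I" using I that by blast
        then show ?thesis by (simp add: mult.commute)
      qed
    qed (use I in auto)
  qed
qed

lemma ideal_pringD:
  assumes "ideal I (pring n)"
  shows "a \<in> I \<Longrightarrow> a \<in> pcarrier n" "0 \<in> I" "a \<in> I \<Longrightarrow> b \<in> I \<Longrightarrow> a + b \<in> I"
    "c \<in> pcarrier n \<Longrightarrow> a \<in> I \<Longrightarrow> c * a \<in> I" "c \<in> pcarrier n \<Longrightarrow> a \<in> I \<Longrightarrow> a * c \<in> I"
    "a \<in> I \<Longrightarrow> - a \<in> I" "a \<in> I \<Longrightarrow> b \<in> I \<Longrightarrow> a - b \<in> I"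
proof -
  note I = assms[unfolded ideal_pring_iff]
  show "a \<in> I \<Longrightarrow> a \<in> pcarrier n" "0 \<in> I" "a \<in> I \<Longrightarrow> b \<in> I \<Longrightarrow> a + b \<in> I"
    "c \<in> pcarrier n \<Longrightarrow> a \<in> I \<Longrightarrow> c * a \<in> I" "c \<in> pcarrier n \<Longrightarrow> a \<in> I \<Longrightarrow> a * c \<in> I"
    using I by (auto simp: mult.commute)
  have neg: "- a \<in> I" if "a \<in> I" for a
    using I that pcarrier_closed(5)[of 1 n] by (metis mult_minus1 pcarrier_closed(2))
  then show "a \<in> I \<Longrightarrow> - a \<in> I" by blast
  show "a - b \<in> I" if "a \<in> I" "b \<in> I"
    using that neg[of b] I by (metis diff_conv_add_uminus)
qed

lemma ideal_pring_sum:
  assumes "ideal I (pring n)" "\<And>i. i \<in> A \<Longrightarrow> f i \<in> I" shows "sum f A \<in> I"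
  using assms(2) by (induction A rule: infinite_finite_induct)
    (auto intro: ideal_pringD(2,3)[OF assms(1)])

section \<open>Homogeneous polynomials and homogeneous components\<close>

definition homog :: "nat \<Rightarrow> 'k::field mpoly \<Rightarrow> bool" where
  "homog d f \<longleftrightarrow> (\<forall>m\<in>Poly_Mapping.keys f. mon_deg m = d)"

definition hcomp :: "nat \<Rightarrow> 'k::field mpoly \<Rightarrow> 'k mpoly" where
  "hcomp d f = Poly_Mapping.mapp (\<lambda>m c. c when mon_deg m = d) f"

lemma ppart_iff: "f \<in> ppart n d \<longleftrightarrow> f \<in> pcarrier n \<and> homog d f"
  by (auto simp: ppart_def homog_def)

text \<open>A larger index set lets the degrees of several monomials be computed over one common
  set.\<close>

lemma mon_deg_eq_sum:
  assumes "finite A" "Poly_Mapping.keys m \<subseteq> A"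
  shows "mon_deg m = (\<Sum>j\<in>A. Poly_Mapping.lookup m j)"
  unfolding mon_deg_def using assms by (intro sum.mono_neutral_left) (auto simp: in_keys_iff)

lemma mon_deg_add [simp]: "mon_deg (a + b) = mon_deg a + mon_deg b"
proof -
  let ?A = "Poly_Mapping.keys a \<union> Poly_Mapping.keys b"
  have "mon_deg x = (\<Sum>j\<in>?A. Poly_Mapping.lookup x j)" if "x \<in> {a, b, a + b}" for x
    by (rule mon_deg_eq_sum) (use that in \<open>auto simp: keys_plus_nat\<close>)
  then show ?thesis by (simp add: lookup_add sum.distrib)
qed

lemma mon_deg_single [simp]: "mon_deg (Poly_Mapping.single j k) = k" "mon_deg 0 = 0"
  by (simp_all add: mon_deg_def)

lemma lookup_hcomp: "Poly_Mapping.lookup (hcomp d f) m = (Poly_Mapping.lookup f m when mon_deg m = d)"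
  by (auto simp: hcomp_def lookup_mapp when_def in_keys_iff)

lemma keys_hcomp: "Poly_Mapping.keys (hcomp d f) = {m \<in> Poly_Mapping.keys f. mon_deg m = d}"
  by (auto simp: in_keys_iff lookup_hcomp)

lemma hcomp_add: "hcomp d (f + g) = hcomp d f + hcomp d g"
  by (rule poly_mapping_eqI) (simp add: lookup_hcomp lookup_add when_def)

lemma hcomp_zero [simp]: "hcomp d 0 = 0"
  by (rule poly_mapping_eqI) (simp add: lookup_hcomp)

lemma hcomp_sum: "hcomp d (sum f A) = (\<Sum>i\<in>A. hcomp d (f i))"
  by (induction A rule: infinite_finite_induct) (auto simp: hcomp_add)

lemma homog_hcomp [simp]: "homog d (hcomp d f)"
  by (auto simp: homog_def keys_hcomp)

lemma hcomp_pcarrier [simp, intro]: "f \<in> pcarrier n \<Longrightarrow> hcomp d f \<in> pcarrier n"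
  by (auto simp: pcarrier_iff keys_hcomp)

lemma hcomp_homog: "homog e f \<Longrightarrow> hcomp d f = (if d = e then f else 0)"
  by (rule poly_mapping_eqI) (auto simp: lookup_hcomp homog_def when_def in_keys_iff)

lemma homog_closed [simp]:
  "homog d 0" "homog d f \<Longrightarrow> homog d g \<Longrightarrow> homog d (f + g)" "homog d f \<Longrightarrow> homog d (- f)"
  "homog d f \<Longrightarrow> homog e g \<Longrightarrow> homog (d + e) (f * g)"
  "homog 0 (pconst c)" "homog 0 1" "homog 1 (pvar j)" "homog (Suc 0) (pvar j)"
proof -
  show "homog d f \<Longrightarrow> homog d g \<Longrightarrow> homog d (f + g)"
    using keys_add[of f g] unfolding homog_def by blast
  show "homog (d + e) (f * g)" if "homog d f" "homog e g"
    unfolding homog_def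
  proof
    fix m assume "m \<in> Poly_Mapping.keys (f * g)"
    then obtain a b where "a \<in> Poly_Mapping.keys f" "b \<in> Poly_Mapping.keys g" "m = a + b"
      by (rule keys_multE)
    then show "mon_deg m = d + e" using that by (auto simp: homog_def)
  qed
qed (auto simp: homog_def pconst_def pvar_def)

lemma mon_deg_bound:
  fixes f :: "'k::field mpoly"
  obtains B where "\<And>m. m \<in> Poly_Mapping.keys f \<Longrightarrow> mon_deg m \<le> B"
proof
  show "mon_deg m \<le> Max (mon_deg ` Poly_Mapping.keys f)" if "m \<in> Poly_Mapping.keys f" for m
    using that by auto
qed

text \<open>The bound is a parameter, so that polynomials of different degrees can be decomposed
  with one common range of summation.\<close>

lemma sum_hcomp:
  assumes "\<And>m. m \<in> Poly_Mapping.keys f \<Longrightarrow> mon_deg m \<le> B"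
  shows "(\<Sum>d\<le>B. hcomp d f) = f"
proof (rule poly_mapping_eqI)
  fix m
  have "(\<Sum>d\<le>B. (Poly_Mapping.lookup f m when mon_deg m = d)) = Poly_Mapping.lookup f m"
  proof (cases "m \<in> Poly_Mapping.keys f")
    case True
    then show ?thesis using assms[of m] by (simp add: when_def sum.delta')
  qed (simp add: in_keys_iff)
  then show "Poly_Mapping.lookup (\<Sum>d\<le>B. hcomp d f) m = Poly_Mapping.lookup f m"
    by (simp add: lookup_sum lookup_hcomp)
qed

lemma hcomp_eq_zero:
  assumes "\<And>m. m \<in> Poly_Mapping.keys f \<Longrightarrow> mon_deg m \<le> B" "d > B"
  shows "hcomp d f = 0"
proof (rule poly_mapping_eqI)
  fix m
  have "\<not> (m \<in> Poly_Mapping.keys f \<and> mon_deg m = d)" using assms(1)[of m] assms(2) by auto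
  then show "Poly_Mapping.lookup (hcomp d f) m = Poly_Mapping.lookup 0 m"
    by (auto simp: lookup_hcomp when_def in_keys_iff)
qed

text \<open>A polynomial is a finite sum of its homogeneous components, so an additive statement has
  to be checked on homogeneous polynomials only.\<close>

lemma homog_induct [consumes 1, case_names homog add]:
  assumes f: "f \<in> pcarrier n"
    and homog: "\<And>d f. f \<in> pcarrier n \<Longrightarrow> homog d f \<Longrightarrow> P f"
    and add: "\<And>f g. f \<in> pcarrier n \<Longrightarrow> g \<in> pcarrier n \<Longrightarrow> P f \<Longrightarrow> P g \<Longrightarrow> P (f + g)"
  shows "P f"
proof -
  obtain B where B: "\<And>m. m \<in> Poly_Mapping.keys f \<Longrightarrow> mon_deg m \<le> B" using mon_deg_bound by blast
  have "P (\<Sum>d\<in>A. hcomp d f)" if "finite A" for A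
    using that
  proof (induction A)
    case empty
    \<comment> \<open>The zero polynomial counts as homogeneous in every degree; degree
      \<open>0\<close> is picked here.\<close>
    show ?case using homog[of 0 0] by simp
  next
    case (insert x A)
    then show ?case using f homog[of "hcomp x f" x]
      by (auto intro!: add pcarrier_sum)
  qed
  from this[of "{..B}"] show ?thesis using sum_hcomp[of f B, OF B] by simp
qed

text \<open>A homogeneous factor of degree \<open>a\<close> shifts degrees by \<open>a\<close>.
  Below degree \<open>a\<close> nothing arises, and there the truncated \<open>d - a\<close> would
  give a wrong index.\<close>

lemma hcomp_mult_homog:
  assumes g: "homog a g" and f: "f \<in> pcarrier n"
  shows "hcomp d (g * f) = (if a \<le> d then g * hcomp (d - a) f else 0)"
  using f
proof (induction rule: homog_induct)
  case (homog e f)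
  then have "homog (a + e) (g * f)" using g by simp
  then show ?case using homog by (auto simp: hcomp_homog)
next
  case (add f g)
  then show ?case by (simp add: hcomp_add distrib_left)
qed

text \<open>Both sides are additive in \<open>g\<close>, so \<open>g\<close> may be taken
  homogeneous of some degree \<open>a\<close>; then at most the summand \<open>e = a\<close>
  survives.\<close>

lemma hcomp_mult:
  assumes g: "g \<in> pcarrier n" and f: "f \<in> pcarrier n"
  shows "hcomp d (g * f) = (\<Sum>e\<le>d. hcomp e g * hcomp (d - e) f)"
  using g
proof (induction rule: homog_induct)
  case (homog a g)
  have "(\<Sum>e\<le>d. hcomp e g * hcomp (d - e) f) = (\<Sum>e\<le>d. if e = a then g * hcomp (d - e) f else 0)"
    by (intro sum.cong) (auto simp: hcomp_homog[OF homog(2)])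
  then show ?case using hcomp_mult_homog[OF homog(2) f] by (simp add: sum.delta)
next
  case (add f g)
  then show ?case by (simp add: hcomp_add distrib_right sum.distrib)
qed

text \<open>The elements of \<open>I\<close> all of whose components lie in \<open>I\<close> form an
  ideal; if \<open>I\<close> is generated by homogeneous elements, this ideal contains the
  generators and is all of \<open>I\<close>. Conversely, every element is the sum of its
  components.\<close>

lemma homogeneous_ideal_iff:
  fixes I :: "'k::field mpoly set"
  shows "homogeneous_ideal n I \<longleftrightarrow> ideal I (pring n) \<and> (\<forall>f\<in>I. \<forall>d. hcomp d f \<in> I)"
proof (intro iffI conjI ballI allI)
  interpret P: cring "pring n :: 'k::field mpoly ring" by (rule cring_pring)
  let ?H = "I \<inter> (\<Union>d. ppart n d)"
  {
    assume I: "homogeneous_ideal n I"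
    then show id: "ideal I (pring n)" by (simp add: homogeneous_ideal_def)
    fix f d assume f: "f \<in> I"
    let ?T = "{f \<in> I. \<forall>d. hcomp d f \<in> I}"
    have "ideal ?T (pring n)"
      unfolding ideal_pring_iff
    proof (intro conjI ballI)
      fix c f :: "'k mpoly" assume c: "c \<in> pcarrier n" and f: "f \<in> ?T"
      then have fI: "f \<in> I" and fP: "f \<in> pcarrier n" using ideal_pringD[OF id] by auto
      have "hcomp d (c * f) \<in> I" for d
        unfolding hcomp_mult[OF c fP]
        by (intro ideal_pring_sum[OF id] ideal_pringD(4)[OF id]) (use c f in auto)
      then show "c * f \<in> ?T" using ideal_pringD(4)[OF id c fI] by simp
    qed (use ideal_pringD[OF id] in \<open>auto simp: hcomp_add\<close>)
    moreover have "?H \<subseteq> ?T"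
      using ideal_pringD(2)[OF id] by (auto simp: ppart_iff hcomp_homog)
    ultimately have "Idl\<^bsub>pring n\<^esub> ?H \<subseteq> ?T" by (rule P.genideal_minimal)
    then show "hcomp d f \<in> I" using I f by (auto simp: homogeneous_ideal_def)
  }
  assume I: "ideal I (pring n) \<and> (\<forall>f\<in>I. \<forall>d. hcomp d f \<in> I)"
  then have id: "ideal I (pring n)" by simp
  have "I \<subseteq> pcarrier n" using ideal_pringD(1)[OF id] by blast
  then have sub: "?H \<subseteq> pcarrier n" by blast
  have "f \<in> Idl\<^bsub>pring n\<^esub> ?H" if f: "f \<in> I" for f
  proof -
    obtain B where B: "\<And>m. m \<in> Poly_Mapping.keys f \<Longrightarrow> mon_deg m \<le> B" using mon_deg_bound by blast
    have "hcomp d f \<in> ?H" for d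
      using f I ideal_pringD(1)[OF id f] by (auto simp: ppart_iff intro: homog_hcomp)
    then have "hcomp d f \<in> Idl\<^bsub>pring n\<^esub> ?H" for d
      by (rule subsetD[OF P.genideal_self[OF sub]])
    then have "(\<Sum>d\<le>B. hcomp d f) \<in> Idl\<^bsub>pring n\<^esub> ?H"
      by (intro ideal_pring_sum[OF P.genideal_ideal[OF sub]])
    then show ?thesis using sum_hcomp[of f B, OF B] by simp
  qed
  moreover have "Idl\<^bsub>pring n\<^esub> ?H \<subseteq> I" by (rule P.genideal_minimal[OF id]) simp
  ultimately show "homogeneous_ideal n I" using id by (auto simp: homogeneous_ideal_def)
qed

section \<open>Homogeneous primes, obtained by adjoining elements and Zorn's lemma\<close>

definition adjoin :: "nat \<Rightarrow> 'k::field mpoly set \<Rightarrow> 'k mpoly \<Rightarrow> 'k mpoly set" where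
  "adjoin n I a = {t + c * a | t c. t \<in> I \<and> c \<in> pcarrier n}"

lemma adjoinI: "t \<in> I \<Longrightarrow> c \<in> pcarrier n \<Longrightarrow> f = t + c * a \<Longrightarrow> f \<in> adjoin n I a"
  by (auto simp: adjoin_def)

text \<open>Here \<open>adjoin n I a\<close> is the ideal \<open>I + (a)\<close>. The component of
  degree \<open>d\<close> of \<open>t + c * a\<close> is that of \<open>t\<close> plus
  \<open>a\<close> times the component of \<open>c\<close> in degree \<open>d - s\<close>.\<close>

lemma homogeneous_ideal_adjoin:
  fixes I :: "'k::field mpoly set"
  assumes I: "homogeneous_ideal n I" and a: "a \<in> ppart n s"
  shows "homogeneous_ideal n (adjoin n I a)"
proof -
  have id: "ideal I (pring n)" and hc: "\<And>f d. f \<in> I \<Longrightarrow> hcomp d f \<in> I"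
    using I by (auto simp: homogeneous_ideal_iff)
  have aP: "a \<in> pcarrier n" and ha: "homog s a" using a by (auto simp: ppart_iff)
  show ?thesis
    unfolding homogeneous_ideal_iff
  proof (intro conjI ballI allI)
    show "ideal (adjoin n I a) (pring n)"
      unfolding ideal_pring_iff
    proof (intro conjI ballI)
      show "adjoin n I a \<subseteq> pcarrier n" using aP ideal_pringD(1)[OF id] by (auto simp: adjoin_def)
      show "0 \<in> adjoin n I a" by (rule adjoinI[of 0 _ 0]) (use ideal_pringD(2)[OF id] in auto)
    next
      fix f g assume "f \<in> adjoin n I a" "g \<in> adjoin n I a"
      then obtain t c t' c' where *: "t \<in> I" "c \<in> pcarrier n" "t' \<in> I" "c' \<in> pcarrier n"
        "f = t + c * a" "g = t' + c' * a" by (auto simp: adjoin_def)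
      show "f + g \<in> adjoin n I a"
        by (rule adjoinI[of "t + t'" _ "c + c'"])
          (use * ideal_pringD(3)[OF id] in \<open>auto simp: algebra_simps\<close>)
    next
      fix c f :: "'k mpoly" assume c: "c \<in> pcarrier n" and "f \<in> adjoin n I a"
      then obtain t c' where *: "t \<in> I" "c' \<in> pcarrier n" "f = t + c' * a" by (auto simp: adjoin_def)
      show "c * f \<in> adjoin n I a"
        by (rule adjoinI[of "c * t" _ "c * c'"])
          (use * c ideal_pringD(4)[OF id] in \<open>auto simp: algebra_simps\<close>)
    qed
  next
    fix f d assume "f \<in> adjoin n I a"
    then obtain t c where *: "t \<in> I" "c \<in> pcarrier n" "f = t + c * a" by (auto simp: adjoin_def)
    \<comment> \<open>For \<open>d < s\<close> the coefficient of \<open>a\<close> has to be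
      \<open>0\<close>, since \<open>d - s\<close> is truncated.\<close>
    show "hcomp d f \<in> adjoin n I a"
      by (rule adjoinI[of "hcomp d t" _ "if s \<le> d then hcomp (d - s) c else 0"])
        (use * hc hcomp_mult_homog[OF ha *(2)] in \<open>auto simp: hcomp_add mult.commute\<close>)
  qed
qed

text \<open>An ideal maximal among the homogeneous ideals over \<open>J\<close> that miss all powers
  of \<open>x\<close> is prime. Maximality is first exploited for homogeneous elements, since
  adjoining these keeps the ideal homogeneous; general elements are then reduced to their
  components.\<close>

lemma exists_homogeneous_prime:
  fixes J :: "'k::field mpoly set"
  assumes J: "homogeneous_ideal n J" and x: "x \<in> pcarrier n" and pow: "\<And>k. x ^ k \<notin> J"
  obtains \<pp> where "primeideal \<pp> (pring n)" "homogeneous_ideal n \<pp>" "J \<subseteq> \<pp>" "x \<notin> \<pp>"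
proof -
  let ?S = "{T. homogeneous_ideal n T \<and> J \<subseteq> T \<and> (\<forall>k. x ^ k \<notin> T)}"
  have "\<exists>M\<in>?S. \<forall>X\<in>?S. M \<subseteq> X \<longrightarrow> X = M"
  proof (rule subset_Zorn_nonempty)
    show "?S \<noteq> {}" using J pow by blast
    fix \<C> assume ne: "\<C> \<noteq> {}" and ch: "subset.chain ?S \<C>"
    have S: "homogeneous_ideal n T" "J \<subseteq> T" "\<And>k. x ^ k \<notin> T" if "T \<in> \<C>" for T
      using that ch by (auto simp: subset.chain_def)
    have lin: "T \<subseteq> T' \<or> T' \<subseteq> T" if "T \<in> \<C>" "T' \<in> \<C>" for T T'
      using that ch by (auto simp: subset.chain_def)
    have id: "ideal T (pring n)" and hc: "\<And>f d. f \<in> T \<Longrightarrow> hcomp d f \<in> T" if "T \<in> \<C>" for T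
      using S(1)[OF that] by (auto simp: homogeneous_ideal_iff)
    \<comment> \<open>The union of a chain is an upper bound: any two of its elements lie in one
      common member, where their sum can be formed.\<close>
    have "homogeneous_ideal n (\<Union>\<C>)"
      unfolding homogeneous_ideal_iff
    proof (intro conjI ballI allI)
      show "ideal (\<Union>\<C>) (pring n)"
        unfolding ideal_pring_iff
      proof (intro conjI ballI)
        show "\<Union>\<C> \<subseteq> pcarrier n" using ideal_pringD(1)[OF id] by blast
        show "0 \<in> \<Union>\<C>" using ideal_pringD(2)[OF id] ne by blast
        show "c * a \<in> \<Union>\<C>" if "c \<in> pcarrier n" "a \<in> \<Union>\<C>" for c a
          using that ideal_pringD(4)[OF id] by blast
        fix a b assume "a \<in> \<Union>\<C>" "b \<in> \<Union>\<C>"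
        then obtain T T' where T: "T \<in> \<C>" "T' \<in> \<C>" "a \<in> T" "b \<in> T'" by blast
        then have "(a \<in> T \<and> b \<in> T) \<or> (a \<in> T' \<and> b \<in> T')" using lin by blast
        then show "a + b \<in> \<Union>\<C>" using T ideal_pringD(3)[OF id] by blast
      qed
    qed (use hc in blast)
    then show "\<Union>\<C> \<in> ?S" using ne S by blast
  qed
  then obtain \<pp> where \<pp>S: "\<pp> \<in> ?S" and max: "\<forall>X\<in>?S. \<pp> \<subseteq> X \<longrightarrow> X = \<pp>" by (rule bexE)
  have \<pp>: "homogeneous_ideal n \<pp>" "J \<subseteq> \<pp>" "\<And>k. x ^ k \<notin> \<pp>"
    using \<pp>S by simp_all
  have id: "ideal \<pp> (pring n)" and hc: "\<And>f d. f \<in> \<pp> \<Longrightarrow> hcomp d f \<in> \<pp>"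
    using \<pp>(1) by (auto simp: homogeneous_ideal_iff)
  have adj: "\<exists>k. x ^ k \<in> adjoin n \<pp> a" if a: "a \<in> ppart n s" "a \<notin> \<pp>" for a s
  proof (rule ccontr)
    assume c: "\<not> ?thesis"
    have sub: "\<pp> \<subseteq> adjoin n \<pp> a" by (auto intro: adjoinI[of _ _ 0])
    then have "adjoin n \<pp> a \<in> ?S"
      using homogeneous_ideal_adjoin[OF \<pp>(1) a(1)] c \<pp>(2) by simp
    then have "adjoin n \<pp> a = \<pp>" using bspec[OF max] sub by simp
    moreover have "a \<in> adjoin n \<pp> a"
      by (rule adjoinI[of 0 _ 1]) (use ideal_pringD(2)[OF id] in auto)
    ultimately show False using a(2) by simp
  qed
  have homog_prime: "a \<in> \<pp> \<or> b \<in> \<pp>"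
    if a: "a \<in> ppart n s" and b: "b \<in> ppart n t" and ab: "a * b \<in> \<pp>" for a b s t
  proof (rule ccontr)
    assume "\<not> ?thesis"
    then obtain k l where "x ^ k \<in> adjoin n \<pp> a" "x ^ l \<in> adjoin n \<pp> b"
      using adj a b by blast
    then obtain u c v e where *: "x ^ k = u + c * a" "x ^ l = v + e * b" "u \<in> \<pp>" "v \<in> \<pp>"
      "c \<in> pcarrier n" "e \<in> pcarrier n" by (auto simp: adjoin_def)
    have P: "a \<in> pcarrier n" "b \<in> pcarrier n" "u \<in> pcarrier n" "v \<in> pcarrier n"
      using a b * ideal_pringD(1)[OF id] by (auto simp: ppart_iff)
    \<comment> \<open>The product of \<open>u + c * a\<close> and \<open>v + e * b\<close>: every
      term has a factor in \<open>\<pp>\<close>, the last one the factor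
      \<open>a * b\<close>.\<close>
    have "x ^ (k + l) = (v + e * b) * u + (c * a) * v + (c * e) * (a * b)"
      by (simp add: power_add * algebra_simps)
    also have "\<dots> \<in> \<pp>"
    proof -
      have "(v + e * b) * u \<in> \<pp>" "(c * a) * v \<in> \<pp>" "(c * e) * (a * b) \<in> \<pp>"
        using * P ab by (simp_all add: ideal_pringD(4)[OF id])
      then show ?thesis by (intro ideal_pringD(3)[OF id])
    qed
    finally show False using \<pp>(3) by blast
  qed
  have prime: "a \<in> \<pp> \<or> b \<in> \<pp>"
    if a: "a \<in> pcarrier n" and b: "b \<in> pcarrier n" and ab: "a * b \<in> \<pp>" for a b
  proof (rule ccontr)
    assume neg: "\<not> ?thesis"
    \<comment> \<open>For an element outside \<open>\<pp>\<close>, take the highest degree whose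
      component is outside \<open>\<pp>\<close>; it exists because the components of large degree
      vanish.\<close>
    have top: "\<exists>s. hcomp s f \<notin> \<pp> \<and> (\<forall>e>s. hcomp e f \<in> \<pp>)" if f: "f \<notin> \<pp>" for f
    proof -
      obtain B where B: "\<And>m. m \<in> Poly_Mapping.keys f \<Longrightarrow> mon_deg m \<le> B" using mon_deg_bound by blast
      let ?D = "{s. hcomp s f \<notin> \<pp>}"
      have le: "s \<le> B" if "s \<in> ?D" for s
        using that hcomp_eq_zero[of f B s, OF B] ideal_pringD(2)[OF id] by (cases "s \<le> B") auto
      then have fin: "finite ?D" by (meson finite_nat_set_iff_bounded_le)
      have "?D \<noteq> {}"
      proof
        assume "?D = {}"
        then have "(\<Sum>d\<le>B. hcomp d f) \<in> \<pp>" by (intro ideal_pring_sum[OF id]) auto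
        then show False using f sum_hcomp[of f B, OF B] by simp
      qed
      then have "Max ?D \<in> ?D" using fin Max_in by blast
      moreover have "e \<notin> ?D" if "e > Max ?D" for e using that fin Max_ge[of ?D e] by linarith
      ultimately show ?thesis by blast
    qed
    from neg obtain s t where s: "hcomp s a \<notin> \<pp>" "\<And>e. e > s \<Longrightarrow> hcomp e a \<in> \<pp>"
      and t: "hcomp t b \<notin> \<pp>" "\<And>e. e > t \<Longrightarrow> hcomp e b \<in> \<pp>"
      using top[of a] top[of b] by blast
    \<comment> \<open>In degree \<open>s + t\<close> of \<open>a * b\<close>, every product other
      than that of the two chosen components has a factor of degree above \<open>s\<close> in
      \<open>a\<close> or above \<open>t\<close> in \<open>b\<close>, hence lies in
      \<open>\<pp>\<close>.\<close>
    let ?g = "\<lambda>e. hcomp e a * hcomp (s + t - e) b"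
    have eq: "hcomp (s + t) (a * b) = hcomp s a * hcomp t b + (\<Sum>e\<in>{..s + t} - {s}. ?g e)"
      by (simp add: hcomp_mult[OF a b] sum.remove[of "{..s + t}" s])
    have "?g e \<in> \<pp>" if "e \<in> {..s + t} - {s}" for e
    proof (cases "e > s")
      case True
      then show ?thesis using s(2) b by (intro ideal_pringD(5)[OF id]) auto
    next
      case False
      then have "s + t - e > t" using that by auto
      then show ?thesis using t(2) a by (intro ideal_pringD(4)[OF id]) auto
    qed
    then have "(\<Sum>e\<in>{..s + t} - {s}. ?g e) \<in> \<pp>" by (rule ideal_pring_sum[OF id])
    moreover have "hcomp (s + t) (a * b) \<in> \<pp>" using hc ab by blast
    ultimately have "hcomp (s + t) (a * b) - (\<Sum>e\<in>{..s + t} - {s}. ?g e) \<in> \<pp>"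
      by (intro ideal_pringD(7)[OF id])
    then have "hcomp s a * hcomp t b \<in> \<pp>" by (simp add: eq)
    then show False
      using homog_prime[of "hcomp s a" s "hcomp t b" t] s(1) t(1) a b by (auto simp: ppart_iff)
  qed
  \<comment> \<open>The powers \<open>x ^ 0\<close> and \<open>x ^ 1\<close> yield that
    \<open>\<pp>\<close> is proper and that \<open>x\<close> lies outside it.\<close>
  have "1 \<notin> \<pp>" using \<pp>(3)[of 0] by simp
  then have "primeideal \<pp> (pring n)"
    using prime by (intro primeidealI[OF id cring_pring]) auto
  moreover have "x \<notin> \<pp>" using \<pp>(3)[of 1] by simp
  ultimately show thesis using that \<pp> by blast
qed

section \<open>The Euler derivation
  \<open>\<Sum>\<^sub>j X\<^sub>j \<partial>/\<partial>X\<^sub>j\<close> on polynomials\<close>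

definition euler_op :: "'k::field mpoly \<Rightarrow> 'k mpoly" where
  "euler_op f = Poly_Mapping.mapp (\<lambda>m c. of_nat (mon_deg m) * c) f"

lemma lookup_euler_op:
  "Poly_Mapping.lookup (euler_op f) m = of_nat (mon_deg m) * Poly_Mapping.lookup f m"
  by (auto simp: euler_op_def lookup_mapp when_def in_keys_iff)

lemma lookup_of_nat_mult:
  "Poly_Mapping.lookup (of_nat k * f) m = of_nat k * Poly_Mapping.lookup f m" for f :: "'k::field mpoly"
  by (induction k) (simp_all add: lookup_add distrib_right)

lemma euler_op_add: "euler_op (f + g) = euler_op f + euler_op g"
  by (rule poly_mapping_eqI) (simp add: lookup_euler_op lookup_add distrib_left)

lemma euler_op_sum: "euler_op (sum f A) = (\<Sum>i\<in>A. euler_op (f i))"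
proof -
  have "euler_op 0 = 0" by (rule poly_mapping_eqI) (simp add: lookup_euler_op)
  then show ?thesis by (induction A rule: infinite_finite_induct) (auto simp: euler_op_add)
qed

lemma euler_op_homog: "homog d f \<Longrightarrow> euler_op f = of_nat d * f"
  by (rule poly_mapping_eqI) (auto simp: lookup_euler_op lookup_of_nat_mult homog_def in_keys_iff)

lemma pcarrier_of_nat [simp, intro]: "of_nat k \<in> pcarrier n"
  by (induction k) auto

lemma euler_op_pcarrier [simp, intro]: "f \<in> pcarrier n \<Longrightarrow> euler_op f \<in> pcarrier n"
  by (auto simp: pcarrier_iff in_keys_iff lookup_euler_op)

text \<open>By additivity in both factors it suffices to treat \<open>f\<close> and \<open>g\<close>
  homogeneous of degrees \<open>d\<close> and \<open>e\<close>, where both sides are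
  \<open>d + e\<close> times the product.\<close>

lemma euler_op_mult:
  assumes f: "f \<in> pcarrier n" and g: "g \<in> pcarrier n"
  shows "euler_op (f * g) = f * euler_op g + g * euler_op f"
  using f
proof (induction rule: homog_induct)
  case (homog d f)
  from g show ?case
  proof (induction rule: homog_induct)
    case (homog e g)
    then show ?case using euler_op_homog[OF homog_closed(4)[OF \<open>homog d f\<close> homog(2)]]
      \<open>homog d f\<close> by (simp add: euler_op_homog algebra_simps)
  next
    case (add g h)
    then show ?case by (simp add: euler_op_add algebra_simps)
  qed
next
  case (add f h)
  then show ?case by (simp add: euler_op_add algebra_simps)
qed

text \<open>Each component of \<open>f\<close> lies in \<open>I\<close> and is multiplied by its
  degree. This lets the Euler derivation descend to the quotient.\<close>

lemma euler_op_homogeneous_ideal: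
  assumes I: "homogeneous_ideal n I" and f: "f \<in> I"
  shows "euler_op f \<in> I"
proof -
  have id: "ideal I (pring n)" and hc: "\<And>d. hcomp d f \<in> I"
    using I f by (auto simp: homogeneous_ideal_iff)
  obtain B where B: "\<And>m. m \<in> Poly_Mapping.keys f \<Longrightarrow> mon_deg m \<le> B" using mon_deg_bound by blast
  have "euler_op f = euler_op (\<Sum>d\<le>B. hcomp d f)" using sum_hcomp[of f B, OF B] by simp
  also have "\<dots> = (\<Sum>d\<le>B. of_nat d * hcomp d f)"
    unfolding euler_op_sum by (intro sum.cong euler_op_homog refl homog_hcomp)
  also have "\<dots> \<in> I" using hc by (intro ideal_pring_sum[OF id] ideal_pringD(4)[OF id]) auto
  finally show ?thesis .
qed

section \<open>Powers of the irrelevant ideal and polynomials of high degree\<close>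

lemma pvar_irrelevant:
  assumes "j \<le> n" shows "(pvar j :: 'k::field mpoly) \<in> irrelevant_ideal n"
proof -
  interpret P: cring "pring n :: 'k mpoly ring" by (rule cring_pring)
  have "pvar ` {..n} \<subseteq> (pcarrier n :: 'k mpoly set)" by auto
  then show ?thesis
    unfolding irrelevant_ideal_def using assms P.genideal_self by blast
qed

lemma ideal_degree_ge:
  "ideal {f \<in> pcarrier n. \<forall>m\<in>Poly_Mapping.keys f. k \<le> mon_deg m} (pring n :: 'k::field mpoly ring)"
  unfolding ideal_pring_iff
proof (intro conjI ballI)
  fix a b :: "'k mpoly"
  assume "a \<in> {f \<in> pcarrier n. \<forall>m\<in>Poly_Mapping.keys f. k \<le> mon_deg m}"
    "b \<in> {f \<in> pcarrier n. \<forall>m\<in>Poly_Mapping.keys f. k \<le> mon_deg m}"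
  then show "a + b \<in> {f \<in> pcarrier n. \<forall>m\<in>Poly_Mapping.keys f. k \<le> mon_deg m}"
    using keys_add[of a b] by auto
next
  fix c a :: "'k mpoly"
  assume c: "c \<in> pcarrier n" and a: "a \<in> {f \<in> pcarrier n. \<forall>m\<in>Poly_Mapping.keys f. k \<le> mon_deg m}"
  have "k \<le> mon_deg m" if "m \<in> Poly_Mapping.keys (c * a)" for m
  proof -
    obtain u v where "u \<in> Poly_Mapping.keys c" "v \<in> Poly_Mapping.keys a" "m = u + v"
      using \<open>m \<in> _\<close> by (rule keys_multE)
    then show ?thesis using a by (auto intro: trans_le_add2)
  qed
  then show "c * a \<in> {f \<in> pcarrier n. \<forall>m\<in>Poly_Mapping.keys f. k \<le> mon_deg m}"
    using a c by simp
qed auto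

text \<open>Each factor from the irrelevant ideal raises the least possible degree by one, and a
  lower bound on the degrees survives sums. With \<open>high_degree_in_ideal\<close> this places a
  power of the irrelevant ideal inside a given ideal.\<close>

lemma irrelevant_pow_degree:
  "ideal_pow (pring n) (irrelevant_ideal n :: 'k::field mpoly set) k \<subseteq>
    {f \<in> pcarrier n. \<forall>m\<in>Poly_Mapping.keys f. k \<le> mon_deg m}"
proof (induction k)
  case 0
  then show ?case by (simp add: ideal_pow_def)
next
  case (Suc k)
  interpret P: cring "pring n :: 'k mpoly ring" by (rule cring_pring)
  have irr: "(irrelevant_ideal n :: 'k mpoly set) \<subseteq> {f \<in> pcarrier n. \<forall>m\<in>Poly_Mapping.keys f. 1 \<le> mon_deg m}"
    unfolding irrelevant_ideal_def
    by (intro P.genideal_minimal ideal_degree_ge) (auto simp: pvar_def pcarrier_iff)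
  note id = ideal_degree_ge[of n "Suc k"]
  show ?case
  proof
    fix f :: "'k mpoly" assume "f \<in> ideal_pow (pring n) (irrelevant_ideal n) (Suc k)"
    then have "f \<in> ideal_prod (pring n) (irrelevant_ideal n) (ideal_pow (pring n) (irrelevant_ideal n) k)"
      by (simp add: ideal_pow_def)
    then show "f \<in> {f \<in> pcarrier n. \<forall>m\<in>Poly_Mapping.keys f. Suc k \<le> mon_deg m}"
    proof (induction rule: ideal_prod.induct)
      case (prod i j)
      have i: "i \<in> pcarrier n" "\<And>m. m \<in> Poly_Mapping.keys i \<Longrightarrow> 1 \<le> mon_deg m"
        using subsetD[OF irr prod(1)] by auto
      have j: "j \<in> pcarrier n" "\<And>m. m \<in> Poly_Mapping.keys j \<Longrightarrow> k \<le> mon_deg m"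
        using subsetD[OF Suc prod(2)] by auto
      have "Suc k \<le> mon_deg m" if "m \<in> Poly_Mapping.keys (i * j)" for m
      proof -
        obtain u v where "u \<in> Poly_Mapping.keys i" "v \<in> Poly_Mapping.keys j" "m = u + v"
          using \<open>m \<in> _\<close> by (rule keys_multE)
        then show ?thesis using i(2)[of u] j(2)[of v] by simp
      qed
      then show ?case using i(1) j(1) by simp
    next
      case (sum s1 s2)
      then show ?case unfolding pring_simps by (intro ideal_pringD(3)[OF id])
    qed
  qed
qed

lemma poly_eq_sum_monomials:
  "f = (\<Sum>m\<in>Poly_Mapping.keys f. Poly_Mapping.single m (Poly_Mapping.lookup f m))"
  by (rule poly_mapping_eqI)
     (auto simp: lookup_sum lookup_single when_def sum.delta' in_keys_iff)

text \<open>Splitting off one variable is the step for inductions on the degree of a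
  monomial.\<close>

lemma mon_deg_SucE:
  assumes "mon_deg m = Suc d"
  obtains j m' where "m = m' + Poly_Mapping.single j 1" "mon_deg m' = d"
proof -
  have "Poly_Mapping.keys m \<noteq> {}" using assms by (auto simp: mon_deg_def)
  then obtain j where j: "j \<in> Poly_Mapping.keys m" by blast
  define m' where "m' = m - Poly_Mapping.single j 1"
  have eq: "m = m' + Poly_Mapping.single j 1"
    using j by (intro poly_mapping_eqI)
      (auto simp: m'_def lookup_add lookup_minus lookup_single when_def in_keys_iff)
  then have "mon_deg m' = d" using assms by simp
  then show thesis using that eq by blast
qed

lemma mon_deg_0D: "mon_deg m = 0 \<Longrightarrow> m = 0"
  by (intro poly_mapping_eqI) (auto simp: mon_deg_def in_keys_iff)

text \<open>A monomial of degree \<open>Suc d\<close> is one of degree \<open>d\<close> times one of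
  the \<open>n + 1\<close> variables.\<close>

lemma finite_monomials: "finite {m. Poly_Mapping.keys m \<subseteq> {..n::nat} \<and> mon_deg m = d}"
proof (induction d)
  case 0
  have "{m. Poly_Mapping.keys m \<subseteq> {..n} \<and> mon_deg m = 0} \<subseteq> {0}" using mon_deg_0D by blast
  then show ?case by (rule finite_subset) simp
next
  case (Suc d)
  let ?M = "{m. Poly_Mapping.keys m \<subseteq> {..n} \<and> mon_deg m = d}"
  have "m \<in> (\<Union>j\<in>{..n}. (\<lambda>m. m + Poly_Mapping.single j 1) ` ?M)"
    if m: "Poly_Mapping.keys m \<subseteq> {..n}" "mon_deg m = Suc d" for m
  proof -
    obtain j m' where eq: "m = m' + Poly_Mapping.single j 1" "mon_deg m' = d"
      using mon_deg_SucE[OF m(2)] .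
    then have "m' \<in> ?M" "j \<in> {..n}" using m(1) by (auto simp: keys_plus_nat)
    then show ?thesis using eq(1) by blast
  qed
  then have "{m. Poly_Mapping.keys m \<subseteq> {..n} \<and> mon_deg m = Suc d} \<subseteq>
      (\<Union>j\<in>{..n}. (\<lambda>m. m + Poly_Mapping.single j 1) ` ?M)" by blast
  then show ?case by (rule finite_subset) (use Suc in simp)
qed

text \<open>Constants and variables generate the polynomial ring. The rule serves to express
  differentials of polynomials through the \<open>dx\<^sub>j\<close>.\<close>

lemma pcarrier_induct [consumes 1, case_names const var add mult]:
  assumes f: "f \<in> pcarrier n"
    and const: "\<And>c. P (pconst c)" and var: "\<And>j. j \<le> n \<Longrightarrow> P (pvar j)"
    and add: "\<And>f g. f \<in> pcarrier n \<Longrightarrow> g \<in> pcarrier n \<Longrightarrow> P f \<Longrightarrow> P g \<Longrightarrow> P (f + g)"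
    and mult: "\<And>f g. f \<in> pcarrier n \<Longrightarrow> g \<in> pcarrier n \<Longrightarrow> P f \<Longrightarrow> P g \<Longrightarrow> P (f * g)"
  shows "P f"
proof -
  have zero: "pconst 0 = (0 :: 'a mpoly)" by (simp add: pconst_def)
  \<comment> \<open>Membership in the carrier is proved along with \<open>P\<close>, because the
    cases \<open>add\<close> and \<open>mult\<close> ask for it.\<close>
  have mon: "Poly_Mapping.single m c \<in> pcarrier n \<and> P (Poly_Mapping.single m c)"
    if "mon_deg m = d" "Poly_Mapping.keys m \<subseteq> {..n}" for d m c
    using that
  proof (induction d arbitrary: m)
    case 0
    then have "Poly_Mapping.single m c = pconst c" using mon_deg_0D[of m] by (simp add: pconst_def)
    then show ?case using const by simp
  next
    case (Suc d)
    obtain j m' where m: "m = m' + Poly_Mapping.single j 1" "mon_deg m' = d"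
      using mon_deg_SucE[OF Suc.prems(1)] .
    then have "Poly_Mapping.keys m' \<subseteq> {..n}" and j: "j \<le> n"
      using Suc.prems(2) by (auto simp: keys_plus_nat)
    then have "Poly_Mapping.single m' c \<in> pcarrier n \<and> P (Poly_Mapping.single m' c)"
      using Suc.IH m(2) by simp
    then have "Poly_Mapping.single m' c * pvar j \<in> pcarrier n \<and> P (Poly_Mapping.single m' c * pvar j)"
      using j var[OF j] mult pcarrier_closed(7)[OF j] by simp
    then show ?case by (simp add: pvar_def mult_single m(1))
  qed
  have "(\<Sum>m\<in>A. Poly_Mapping.single m (Poly_Mapping.lookup f m)) \<in> pcarrier n \<and>
      P (\<Sum>m\<in>A. Poly_Mapping.single m (Poly_Mapping.lookup f m))"
    if "finite A" "A \<subseteq> Poly_Mapping.keys f" for A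
    using that
  proof (induction A)
    case empty
    then show ?case using const[of 0] by (simp add: zero)
  next
    case (insert m A)
    then have "Poly_Mapping.keys m \<subseteq> {..n}" using f by (auto simp: pcarrier_iff)
    from mon[OF refl this] insert add show ?case by simp
  qed
  from this[of "Poly_Mapping.keys f"] show ?thesis by (simp flip: poly_eq_sum_monomials)
qed

lemma pvar_power: "pvar j ^ k = Poly_Mapping.single (Poly_Mapping.single j k) 1"
  by (induction k) (simp_all add: pvar_def mult_single single_add[symmetric])

text \<open>Pigeonhole: if the power \<open>e j\<close> of each \<open>X\<^sub>j\<close> lies in
  \<open>J\<close>, a monomial whose degree is at least the sum of the \<open>e j\<close> has some
  exponent at least \<open>e j\<close>, so it is divisible by one of these powers.\<close>

lemma high_degree_in_ideal:
  assumes J: "ideal J (pring n)" and pow: "\<And>j. j \<le> n \<Longrightarrow> \<exists>k. pvar j ^ k \<in> J"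
  obtains k where "\<And>f. f \<in> pcarrier n \<Longrightarrow> \<forall>m\<in>Poly_Mapping.keys f. k \<le> mon_deg m \<Longrightarrow> f \<in> J"
proof -
  from pow obtain e where e: "\<And>j. j \<le> n \<Longrightarrow> pvar j ^ e j \<in> J" by metis
  define k where "k = (\<Sum>j\<le>n. e j)"
  have "f \<in> J" if f: "f \<in> pcarrier n" and deg: "\<forall>m\<in>Poly_Mapping.keys f. k \<le> mon_deg m" for f
  proof -
    have "Poly_Mapping.single m (Poly_Mapping.lookup f m) \<in> J" if m: "m \<in> Poly_Mapping.keys f" for m
    proof -
      have km: "Poly_Mapping.keys m \<subseteq> {..n}" using f m by (auto simp: pcarrier_iff)
      have "\<exists>j\<le>n. e j \<le> Poly_Mapping.lookup m j"
      proof (rule ccontr)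
        assume "\<not> ?thesis"
        then have "Poly_Mapping.lookup m j < e j" if "j \<le> n" for j using that not_le by blast
        then have "(\<Sum>j\<le>n. Poly_Mapping.lookup m j) < k"
          unfolding k_def by (intro sum_strict_mono) auto
        then show False using deg m mon_deg_eq_sum[OF _ km] by force
      qed
      then obtain j where j: "j \<le> n" "e j \<le> Poly_Mapping.lookup m j" by blast
      let ?m' = "m - Poly_Mapping.single j (e j)"
      have m': "m = ?m' + Poly_Mapping.single j (e j)"
        using j(2) by (intro poly_mapping_eqI)
          (auto simp: lookup_add lookup_minus lookup_single when_def)
      have "Poly_Mapping.keys ?m' \<subseteq> {..n}"
        using km unfolding subset_iff in_keys_iff lookup_minus by (metis diff_0_eq_0)
      then have "Poly_Mapping.single ?m' (Poly_Mapping.lookup f m) \<in> pcarrier n"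
        by (auto simp: pcarrier_iff)
      then have "Poly_Mapping.single ?m' (Poly_Mapping.lookup f m) * pvar j ^ e j \<in> J"
        using e[OF j(1)] by (intro ideal_pringD(4)[OF J])
      then show ?thesis by (simp add: pvar_power mult_single m'[symmetric])
    qed
    then have "(\<Sum>m\<in>Poly_Mapping.keys f. Poly_Mapping.single m (Poly_Mapping.lookup f m)) \<in> J"
      by (intro ideal_pring_sum[OF J])
    then show ?thesis by (simp flip: poly_eq_sum_monomials)
  qed
  then show thesis by (rule that)
qed

section \<open>The coordinate ring and its Hilbert function\<close>

lemma (in cring) dimension_mult_image:
  assumes K: "subfield K R" and x: "x \<in> carrier R"
    and nzd: "\<And>a. a \<in> carrier R \<Longrightarrow> x \<otimes> a = \<zero> \<Longrightarrow> a = \<zero>"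
    and E: "dimension m K E"
  shows "dimension m K ((\<otimes>) x ` E)"
  using E K
proof (induction rule: dimension.induct)
  case (zero_dim K)
  then show ?case using x dimension.zero_dim by simp
next
  case (Suc_dim v E m K)
  have E: "E \<subseteq> carrier R" and KR: "K \<subseteq> carrier R"
    using space_subgroup_props(1)[OF Suc_dim(5,3)] subfieldE(3)[OF Suc_dim(5)] .
  \<comment> \<open>Multiplication by \<open>x\<close> carries the extension of \<open>E\<close> by
    the line of \<open>v\<close> to the extension of the image by the line of
    \<open>x \<otimes> v\<close>; since \<open>x\<close> is a non-zerodivisor,
    \<open>x \<otimes> v\<close> stays outside the image of \<open>E\<close>.\<close>
  have "(\<otimes>) x ` line_extension K v E = line_extension K (x \<otimes> v) ((\<otimes>) x ` E)"
  proof -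
    have "x \<otimes> (k \<otimes> v \<oplus> u) = k \<otimes> (x \<otimes> v) \<oplus> x \<otimes> u" if "k \<in> K" "u \<in> E" for k u
      using that x Suc_dim(1) subsetD[OF E] subsetD[OF KR] by (simp add: r_distr m_lcomm)
    then show ?thesis by (force simp: line_extension_mem_iff image_iff)
  qed
  moreover have "x \<otimes> v \<notin> (\<otimes>) x ` E"
  proof
    assume "x \<otimes> v \<in> (\<otimes>) x ` E"
    then obtain u where u: "u \<in> E" "x \<otimes> v = x \<otimes> u" by blast
    then have uR: "u \<in> carrier R" using E by blast
    then have "x \<otimes> (v \<ominus> u) = \<zero>" using u x Suc_dim(1) by (simp add: minus_eq r_distr r_minus r_neg)
    then have "v \<ominus> u = \<zero>" using nzd uR Suc_dim(1) by simp
    then show False using uR u(1) Suc_dim(1,2) by simp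
  qed
  ultimately show ?case using Suc_dim x by (auto intro: dimension.Suc_dim)
qed

text \<open>A base of \<open>E'\<close> consists of \<open>m\<close> independent vectors inside the
  \<open>m\<close>-dimensional space \<open>E\<close>, so it also spans \<open>E\<close>.\<close>

lemma (in ring) dimension_subset_eq:
  assumes K: "subfield K R" and E: "dimension m K E" and E': "dimension m K E'" and sub: "E' \<subseteq> E"
  shows "E' = E"
proof -
  obtain Vs where Vs: "set Vs \<subseteq> carrier R" "independent K Vs" "length Vs = m" "Span K Vs = E'"
    using exists_base[OF K E'] by blast
  have "set Vs \<subseteq> E" using Span_base_incl[OF K Vs(1)] Vs(4) sub by blast
  then show ?thesis using independent_length_eq_dimension[OF K E Vs(2)] Vs(3,4) by blast
qed

lemma subfield_pconst: "subfield (range pconst) (pring n :: 'k::field mpoly ring)"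
proof -
  interpret P: cring "pring n :: 'k mpoly ring" by (rule cring_pring)
  have mult: "pconst a * pconst b = pconst (a * b)" for a b :: 'k
    by (simp add: pconst_def mult_single)
  have add: "pconst a + pconst b = pconst (a + b)" for a b :: 'k
    by (simp add: pconst_def single_add)
  have one: "pconst 1 = (1 :: 'k mpoly)" by (simp add: pconst_def)
  have inj: "pconst a = 0 \<longleftrightarrow> a = 0" for a :: 'k
    unfolding pconst_def by (metis single_zero lookup_single_eq lookup_zero)
  have minus: "\<ominus>\<^bsub>pring n\<^esub> pconst a = pconst (- a)" for a :: 'k
    by (intro P.minus_equality) (simp_all, simp add: pconst_def flip: single_add)
  show ?thesis
  proof (rule P.subfieldI)
    show "subcring (range pconst) (pring n :: 'k mpoly ring)"
    proof (rule P.subcringI)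
      show "subring (range pconst) (pring n :: 'k mpoly ring)"
      proof (rule P.subringI)
        show "\<one>\<^bsub>pring n\<^esub> \<in> range (pconst :: 'k \<Rightarrow> _)" using one by (metis pring_simps(3) rangeI)
      qed (auto simp: mult minus add)
    qed (auto simp: mult mult.commute)
    show "Units (pring n \<lparr>carrier := range pconst\<rparr>) = range pconst - {\<zero>\<^bsub>pring n :: 'k mpoly ring\<^esub>}"
    proof -
      have "\<exists>b. pconst b * pconst a = 1 \<and> pconst a * pconst b = 1" if "a \<noteq> 0" for a :: 'k
        using that by (intro exI[of _ "1 / a"]) (simp add: mult one)
      then show ?thesis by (auto simp: Units_def inj)
    qed
  qed
qed

section \<open>Schemes without support on the hyperplane \<open>X\<^sub>0 = 0\<close>\<close>

locale zero_dim_off_hyperplane =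
  fixes n :: nat and I :: "'k::field mpoly set"
  assumes zero_dim: "zero_dim_subscheme n I"
    and points_affine: "\<And>\<pp>. \<pp> \<in> scheme_points n I \<Longrightarrow> pvar 0 \<notin> \<pp>"
begin

lemma I_homogeneous: "homogeneous_ideal n I"
  using zero_dim by (simp add: zero_dim_subscheme_def)

lemma I_ideal: "ideal I (pring n)"
  using I_homogeneous by (simp add: homogeneous_ideal_def)

lemmas I_D = ideal_pringD[OF I_ideal]

text \<open>Dimension 0 includes that the support is non-empty, and a point of it is a proper prime
  containing \<open>I\<close>. Hence \<open>R\<close> is not the zero ring.\<close>

lemma one_notin_I: "1 \<notin> I"
proof
  assume "1 \<in> I"
  obtain \<pp> where \<pp>: "primeideal \<pp> (pring n)" "I \<subseteq> \<pp>"
    using zero_dim by (auto simp: zero_dim_subscheme_def zero_dimensional_def scheme_points_def)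
  then have "1 \<in> \<pp>" using \<open>1 \<in> I\<close> by blast
  then have "\<pp> = pcarrier n"
    using ideal.one_imp_carrier[OF primeideal.axioms(1)[OF \<pp>(1)]] by simp
  then show False using primeideal.I_notcarr[OF \<pp>(1)] by simp
qed

text \<open>The algebraic form of the empty intersection with the hyperplane: were no power of some
  \<open>X\<^sub>j\<close> in \<open>I + (X\<^sub>0)\<close>, a homogeneous prime over this ideal
  without \<open>X\<^sub>j\<close> would be a point of the support on the hyperplane.\<close>

lemma high_degree_in_adjoin:
  obtains k where
    "\<And>f. f \<in> pcarrier n \<Longrightarrow> \<forall>m\<in>Poly_Mapping.keys f. k \<le> mon_deg m \<Longrightarrow> f \<in> adjoin n I (pvar 0)"
proof -
  let ?J = "adjoin n I (pvar 0)"
  have J: "homogeneous_ideal n ?J"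
    by (rule homogeneous_ideal_adjoin[OF I_homogeneous, of _ 1]) (simp add: ppart_iff)
  have "\<exists>k. pvar j ^ k \<in> ?J" if j: "j \<le> n" for j
  proof (rule ccontr)
    assume "\<not> ?thesis"
    then obtain \<pp> where \<pp>: "primeideal \<pp> (pring n)" "homogeneous_ideal n \<pp>" "?J \<subseteq> \<pp>" "pvar j \<notin> \<pp>"
      using exists_homogeneous_prime[OF J pcarrier_closed(7)[OF j]] by blast
    have "I \<subseteq> ?J" by (auto intro: adjoinI[of _ _ 0])
    moreover have "pvar 0 \<in> ?J" by (rule adjoinI[of 0 _ 1]) (auto simp: I_D(2))
    moreover have "\<not> irrelevant_ideal n \<subseteq> \<pp>" using \<pp>(4) pvar_irrelevant[OF j] by blast
    ultimately have "\<pp> \<in> scheme_points n I" "pvar 0 \<in> \<pp>"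
      using \<pp> by (auto simp: scheme_points_def)
    then show False using points_affine by blast
  qed
  moreover have "ideal ?J (pring n)" using J by (simp add: homogeneous_ideal_def)
  ultimately show thesis using high_degree_in_ideal that by blast
qed

text \<open>If \<open>f * pvar 0\<close> lies in \<open>I\<close>, then \<open>f\<close> multiplies
  \<open>I + (X\<^sub>0)\<close> into \<open>I\<close>, hence also a power of the irrelevant ideal;
  saturation gives \<open>f \<in> I\<close>.\<close>

lemma x0_nonzerodivisor:
  assumes f: "f \<in> pcarrier n" and fx: "f * pvar 0 \<in> I"
  shows "f \<in> I"
proof -
  obtain k where k: "\<And>g. g \<in> pcarrier n \<Longrightarrow> \<forall>m\<in>Poly_Mapping.keys g. k \<le> mon_deg m \<Longrightarrow>
    g \<in> adjoin n I (pvar 0)" using high_degree_in_adjoin by blast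
  have "f \<otimes>\<^bsub>pring n\<^esub> g \<in> I" if "g \<in> ideal_pow (pring n) (irrelevant_ideal n) k" for g
  proof -
    have "g \<in> adjoin n I (pvar 0)" using k[of g] subsetD[OF irrelevant_pow_degree that] by blast
    then obtain t c where tc: "t \<in> I" "c \<in> pcarrier n" "g = t + c * pvar 0" by (auto simp: adjoin_def)
    have "f * g = f * t + c * (f * pvar 0)" by (simp add: tc algebra_simps)
    moreover have "f * t \<in> I" "c * (f * pvar 0) \<in> I" using f fx tc I_D(4) by blast+
    ultimately show ?thesis using I_D(3) by simp
  qed
  then show ?thesis using zero_dim f by (auto simp: zero_dim_subscheme_def saturated_def)
qed

text \<open>In high degree \<open>f\<close> has the form \<open>t + c * pvar 0\<close>; taking
  components of degree \<open>Suc d\<close> replaces \<open>c\<close> by its component of degree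
  \<open>d\<close> and keeps \<open>t\<close> in \<open>I\<close>.\<close>

lemma eventually_multiple_of_x0:
  obtains k where "\<And>d f. d \<ge> k \<Longrightarrow> f \<in> ppart n (Suc d) \<Longrightarrow> \<exists>g\<in>ppart n d. f - g * pvar 0 \<in> I"
proof -
  obtain k where k: "\<And>f. f \<in> pcarrier n \<Longrightarrow> \<forall>m\<in>Poly_Mapping.keys f. k \<le> mon_deg m \<Longrightarrow>
    f \<in> adjoin n I (pvar 0)" using high_degree_in_adjoin by blast
  have "\<exists>g\<in>ppart n d. f - g * pvar 0 \<in> I" if d: "d \<ge> k" and f: "f \<in> ppart n (Suc d)" for d f
  proof -
    have "f \<in> adjoin n I (pvar 0)" using k[of f] f d by (auto simp: ppart_iff homog_def)
    then obtain t c where tc: "t \<in> I" "c \<in> pcarrier n" "f = t + c * pvar 0" by (auto simp: adjoin_def)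
    have "f = hcomp (Suc d) f" using f hcomp_homog[of "Suc d" f "Suc d"] by (simp add: ppart_iff)
    also have "\<dots> = hcomp (Suc d) t + hcomp d c * pvar 0"
      using hcomp_mult_homog[of 1 "pvar 0" c n "Suc d"] tc by (simp add: hcomp_add mult.commute)
    finally have "f - hcomp d c * pvar 0 = hcomp (Suc d) t" by (simp add: algebra_simps)
    also have "\<dots> \<in> I" using I_homogeneous tc(1) by (simp add: homogeneous_ideal_iff)
    finally show ?thesis using tc(2) by (intro bexI[of _ "hcomp d c"]) (auto simp: ppart_iff)
  qed
  then show thesis by (rule that)
qed

section \<open>The coordinate ring and its graded pieces over the field of constants\<close>

abbreviation "R \<equiv> coord_ring n I"
abbreviation "cl \<equiv> rclass n I"
abbreviation "K \<equiv> rscalars n I"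

sublocale P: cring "pring n :: 'k mpoly ring"
  by (rule cring_pring)

sublocale R: cring R
  unfolding coord_ring_def by (rule ideal.quotient_is_cring[OF I_ideal cring_pring])

sublocale cl: ring_hom_cring "pring n :: 'k mpoly ring" R cl
proof
  have "cl = (\<lambda>f. I +>\<^bsub>pring n\<^esub> f)" by (simp add: rclass_def fun_eq_iff)
  then show "cl \<in> ring_hom (pring n) R"
    using ideal.rcos_ring_hom[OF I_ideal] by (simp add: coord_ring_def)
qed

lemma R_carrier: "carrier R = cl ` pcarrier n"
  by (auto simp: coord_ring_def FactRing_def A_RCOSETS_def' rclass_def)

lemma cl_simps [simp]:
  "f \<in> pcarrier n \<Longrightarrow> cl f \<in> carrier R"
  "f \<in> pcarrier n \<Longrightarrow> g \<in> pcarrier n \<Longrightarrow> cl (f + g) = cl f \<oplus>\<^bsub>R\<^esub> cl g"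
  "f \<in> pcarrier n \<Longrightarrow> g \<in> pcarrier n \<Longrightarrow> cl (f * g) = cl f \<otimes>\<^bsub>R\<^esub> cl g"
  "cl 0 = \<zero>\<^bsub>R\<^esub>" "cl 1 = \<one>\<^bsub>R\<^esub>"
  using cl.hom_add[of f g] cl.hom_mult[of f g] cl.hom_zero cl.hom_one by simp_all

lemma cl_eq_iff:
  assumes "f \<in> pcarrier n" "g \<in> pcarrier n"
  shows "cl f = cl g \<longleftrightarrow> f - g \<in> I"
proof -
  interpret I: ideal I "pring n" by (rule I_ideal)
  have "cl f = cl g \<longleftrightarrow> f \<ominus>\<^bsub>pring n\<^esub> g \<in> I"
    using assms unfolding rclass_def by (metis P.quotient_eq_iff_same_a_r_cos I_ideal)
  moreover have "\<ominus>\<^bsub>pring n\<^esub> g = - g" using assms by (intro P.minus_equality) auto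
  ultimately show ?thesis by (simp add: a_minus_def)
qed

lemma cl_zero_iff: "f \<in> pcarrier n \<Longrightarrow> cl f = \<zero>\<^bsub>R\<^esub> \<longleftrightarrow> f \<in> I"
  using cl_eq_iff[of f 0] by simp

lemma R_one_not_zero: "\<one>\<^bsub>R\<^esub> \<noteq> \<zero>\<^bsub>R\<^esub>"
  using cl_zero_iff[of 1] one_notin_I by simp

abbreviation "x \<equiv> rvar n I"

lemma x_carrier [simp, intro]: "j \<le> n \<Longrightarrow> x j \<in> carrier R"
  by (simp add: rvar_def)

lemma x0_nzd: 
  assumes a: "a \<in> carrier R" and xa: "x 0 \<otimes>\<^bsub>R\<^esub> a = \<zero>\<^bsub>R\<^esub>"
  shows "a = \<zero>\<^bsub>R\<^esub>"
proof -
  obtain f where f: "f \<in> pcarrier n" "a = cl f" using a by (auto simp: R_carrier)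
  have "cl (f * pvar 0) = \<zero>\<^bsub>R\<^esub>" using f xa by (simp add: rvar_def R.m_comm)
  then have "f * pvar 0 \<in> I" using cl_zero_iff[of "f * pvar 0"] f(1) by blast
  then show ?thesis using x0_nonzerodivisor[OF f(1)] f cl_zero_iff[of f] by simp
qed

text \<open>The image of a field under a homomorphism into a non-zero ring is a field.\<close>

lemma K_subfield: "subfield K R"
  unfolding rscalars_def 
  by (rule ring_hom_ring.img_is_subfield(2)[OF ring_hom_ringI2 subfield_pconst R_one_not_zero])
    (rule P.ring_axioms R.ring_axioms cl.homh)+

lemma K_carrier: "K \<subseteq> carrier R"
  by (rule subfieldE(3)[OF K_subfield])

lemma rpart_carrier: "rpart n I d \<subseteq> carrier R"
  by (auto simp: rpart_def ppart_iff)

text \<open>A \<open>subalgebra\<close> in this sense is an additive subgroup stable under the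
  scalars from \<open>K\<close>, that is, a linear subspace.\<close>

lemma rpart_subalgebra: "subalgebra K (rpart n I d) R"
proof (intro subalgebra.intro R.add.subgroupI subalgebra_axioms.intro)
  show "rpart n I d \<subseteq> carrier R" by (rule rpart_carrier)
  have "0 \<in> ppart n d" by (simp add: ppart_iff)
  then show "rpart n I d \<noteq> {}" by (auto simp: rpart_def)
  show "a \<oplus>\<^bsub>R\<^esub> b \<in> rpart n I d" if ab: "a \<in> rpart n I d" "b \<in> rpart n I d" for a b
  proof -
    obtain f g where fg: "f \<in> ppart n d" "g \<in> ppart n d" "a = cl f" "b = cl g"
      using ab by (auto simp: rpart_def)
    then have "f + g \<in> ppart n d" "a \<oplus>\<^bsub>R\<^esub> b = cl (f + g)" by (auto simp: ppart_iff)
    then show ?thesis by (auto simp: rpart_def)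
  qed
  show "\<ominus>\<^bsub>R\<^esub> a \<in> rpart n I d" if a: "a \<in> rpart n I d" for a
  proof -
    obtain f where f: "f \<in> ppart n d" "a = cl f" using a by (auto simp: rpart_def)
    then have "- f \<in> ppart n d" by (auto simp: ppart_iff)
    moreover have "\<ominus>\<^bsub>R\<^esub> a = cl (- f)"
    proof (rule R.minus_equality)
      have "cl (- f) \<oplus>\<^bsub>R\<^esub> cl f = cl (- f + f)" using f by (subst cl_simps(2)) (auto simp: ppart_iff)
      then show "cl (- f) \<oplus>\<^bsub>R\<^esub> a = \<zero>\<^bsub>R\<^esub>" using f by simp
    qed (use f in \<open>auto simp: ppart_iff\<close>)
    ultimately show ?thesis by (auto simp: rpart_def)
  qed
  show "k \<otimes>\<^bsub>R\<^esub> a \<in> rpart n I d" if k: "k \<in> K" and a: "a \<in> rpart n I d" for k a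
  proof -
    obtain f where f: "f \<in> ppart n d" "a = cl f" using a by (auto simp: rpart_def)
    obtain c where c: "k = cl (pconst c)" using k by (auto simp: rscalars_def)
    have "pconst c * f \<in> ppart n d" using f homog_closed(4)[of 0 "pconst c" d f] by (simp add: ppart_iff)
    moreover have "k \<otimes>\<^bsub>R\<^esub> a = cl (pconst c * f)" using f c by (simp add: ppart_iff)
    ultimately show ?thesis by (auto simp: rpart_def)
  qed
qed

text \<open>The classes of the finitely many monomials of degree \<open>d\<close> span this
  piece.\<close>

lemma rpart_finite_dimension: "R.finite_dimension K (rpart n I d)"
proof -
  let ?M = "{m. Poly_Mapping.keys m \<subseteq> {..n} \<and> mon_deg m = d}"
  let ?g = "\<lambda>m. cl (Poly_Mapping.single m 1)"
  obtain Us where Us: "set Us = ?g ` ?M"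
    using finite_list[OF finite_imageI[OF finite_monomials[of n d], of ?g]] by (elim exE)
  have mon: "Poly_Mapping.single m c \<in> pcarrier n" if "m \<in> ?M" for m and c :: 'k
    using that by (auto simp: pcarrier_iff)
  have UsR: "set Us \<subseteq> carrier R" using Us mon by auto
  have Sp: "subalgebra K (R.Span K Us) R" by (rule R.Span_is_subalgebra[OF K_subfield UsR])
  interpret Sp: subalgebra K "R.Span K Us" R by (rule Sp)
  have "rpart n I d \<subseteq> R.Span K Us"
  proof
    fix a assume "a \<in> rpart n I d"
    then obtain f where f: "f \<in> pcarrier n" "homog d f" "a = cl f" by (auto simp: rpart_def ppart_iff)
    have mono: "Poly_Mapping.single m (Poly_Mapping.lookup f m) \<in> pcarrier n \<and>
        cl (Poly_Mapping.single m (Poly_Mapping.lookup f m)) \<in> R.Span K Us"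
      if m: "m \<in> Poly_Mapping.keys f" for m
    proof -
      have mM: "m \<in> ?M" using m f by (auto simp: pcarrier_iff homog_def)
      have "Poly_Mapping.single m (Poly_Mapping.lookup f m) =
          pconst (Poly_Mapping.lookup f m) * Poly_Mapping.single m 1"
        by (simp add: pconst_def mult_single)
      then have "cl (Poly_Mapping.single m (Poly_Mapping.lookup f m)) =
          cl (pconst (Poly_Mapping.lookup f m)) \<otimes>\<^bsub>R\<^esub> ?g m" using mon[OF mM] by simp
      moreover have "?g m \<in> R.Span K Us"
        using R.Span_base_incl[OF K_subfield UsR] Us mM by blast
      moreover have "cl (pconst (Poly_Mapping.lookup f m)) \<in> K" by (simp add: rscalars_def)
      ultimately show ?thesis using mon[OF mM] Sp.smult_closed by simp
    qed
    \<comment> \<open>The polynomial sum is kept in the carrier during the induction, since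
      additivity of \<open>cl\<close> is stated for polynomials there.\<close>
    have "(\<Sum>m\<in>A. Poly_Mapping.single m (Poly_Mapping.lookup f m)) \<in> pcarrier n \<and>
        cl (\<Sum>m\<in>A. Poly_Mapping.single m (Poly_Mapping.lookup f m)) \<in> R.Span K Us"
      if "finite A" "A \<subseteq> Poly_Mapping.keys f" for A
      using that
    proof (induction A)
      case empty
      then show ?case using Sp.one_closed by simp
    next
      case (insert m A)
      then show ?case using mono[of m] Sp.m_closed by simp
    qed
    from this[of "Poly_Mapping.keys f"] show "a \<in> R.Span K Us"
      using f(3) by (simp flip: poly_eq_sum_monomials)
  qed
  then show ?thesis
    using R.subalbegra_incl_imp_finite_dimension[OF K_subfield
        R.Span_finite_dimension[OF K_subfield UsR] rpart_subalgebra] by blast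
qed

text \<open>Finite dimension makes the number \<open>hilbert_fun\<close>, defined through
  \<open>ring.dim\<close>, an actual dimension.\<close>

lemma rpart_dimension: "R.dimension (hilbert_fun n I d) K (rpart n I d)"
  using R.finite_dimensionE[OF K_subfield rpart_finite_dimension, of d]
  by (simp add: hilbert_fun_def over_def)

section \<open>Multiplication by \<open>x\<^sub>0\<close> and the Hilbert function\<close>

lemma x0_rpart: "(\<otimes>\<^bsub>R\<^esub>) (x 0) ` rpart n I d \<subseteq> rpart n I (Suc d)"
proof
  fix b assume "b \<in> (\<otimes>\<^bsub>R\<^esub>) (x 0) ` rpart n I d"
  then obtain f where f: "f \<in> pcarrier n" "homog d f" "b = x 0 \<otimes>\<^bsub>R\<^esub> cl f"
    by (auto simp: rpart_def ppart_iff)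
  have "pvar 0 * f \<in> ppart n (Suc d)"
    using f homog_closed(4)[of 1 "pvar 0" d f] by (simp add: ppart_iff)
  moreover have "b = cl (pvar 0 * f)" using f by (simp add: rvar_def)
  ultimately show "b \<in> rpart n I (Suc d)" by (auto simp: rpart_def)
qed

lemma x0_rpart_dimension: "R.dimension (hilbert_fun n I d) K ((\<otimes>\<^bsub>R\<^esub>) (x 0) ` rpart n I d)"
  by (rule R.dimension_mult_image[OF K_subfield _ x0_nzd rpart_dimension]) simp_all

text \<open>From some degree on every homogeneous element is a multiple of \<open>x\<^sub>0\<close>,
  and multiplication by \<open>x\<^sub>0\<close> preserves dimension, so consecutive values
  agree.\<close>

lemma hilbert_fun_eventually_constant: "\<exists>k. \<forall>d\<ge>k. hilbert_fun n I d = hilbert_fun n I k"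
proof -
  obtain k where k: "\<And>d f. d \<ge> k \<Longrightarrow> f \<in> ppart n (Suc d) \<Longrightarrow> \<exists>g\<in>ppart n d. f - g * pvar 0 \<in> I"
    using eventually_multiple_of_x0 by blast
  have step: "hilbert_fun n I (Suc d) = hilbert_fun n I d" if d: "d \<ge> k" for d
  proof -
    have "rpart n I (Suc d) \<subseteq> (\<otimes>\<^bsub>R\<^esub>) (x 0) ` rpart n I d"
    proof
      fix a assume "a \<in> rpart n I (Suc d)"
      then obtain f where f: "f \<in> ppart n (Suc d)" "a = cl f" by (auto simp: rpart_def)
      obtain g where g: "g \<in> ppart n d" "f - g * pvar 0 \<in> I" using k[OF d f(1)] by blast
      have "cl f = cl (g * pvar 0)"
        using g f by (subst cl_eq_iff) (auto simp: ppart_iff)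
      also have "\<dots> = x 0 \<otimes>\<^bsub>R\<^esub> cl g" using g by (simp add: ppart_iff rvar_def R.m_comm)
      finally show "a \<in> (\<otimes>\<^bsub>R\<^esub>) (x 0) ` rpart n I d" using f(2) g(1) by (auto simp: rpart_def)
    qed
    then have "rpart n I (Suc d) = (\<otimes>\<^bsub>R\<^esub>) (x 0) ` rpart n I d" using x0_rpart by blast
    then have "R.dimension (hilbert_fun n I d) K (rpart n I (Suc d))"
      using x0_rpart_dimension[of d] by simp
    then show ?thesis using R.dimension_is_inj[OF K_subfield] rpart_dimension by blast
  qed
  have "hilbert_fun n I d = hilbert_fun n I k" if "d \<ge> k" for d
    using that by (induction d rule: dec_induct) (simp_all add: step)
  then show ?thesis by blast
qed

text \<open>Eventual constancy makes both descriptions meaningful: the \<open>THE\<close> in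
  \<open>scheme_deg\<close> has a unique witness and the \<open>LEAST\<close> in
  \<open>reg_index\<close> ranges over a non-empty set.\<close>

lemma hilbert_fun_reg_index: "d \<ge> reg_index n I \<Longrightarrow> hilbert_fun n I d = scheme_deg n I"
proof -
  obtain k where k: "\<And>d. d \<ge> k \<Longrightarrow> hilbert_fun n I d = hilbert_fun n I k"
    using hilbert_fun_eventually_constant by blast
  have "scheme_deg n I = hilbert_fun n I k"
    unfolding scheme_deg_def
  proof (rule the_equality)
    show "\<forall>\<^sub>F d in sequentially. hilbert_fun n I d = hilbert_fun n I k"
      unfolding eventually_sequentially using k by blast
    fix e assume "\<forall>\<^sub>F d in sequentially. hilbert_fun n I d = e"
    then obtain m where m: "\<And>d. d \<ge> m \<Longrightarrow> hilbert_fun n I d = e"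
      by (auto simp: eventually_sequentially)
    show "e = hilbert_fun n I k" using k[of "max m k"] m[of "max m k"] by simp
  qed
  then have "\<forall>d\<ge>k. hilbert_fun n I d = scheme_deg n I" using k by metis
  then have "\<exists>r. \<forall>d\<ge>r. hilbert_fun n I d = scheme_deg n I" by (rule exI)
  then have "\<forall>d\<ge>reg_index n I. hilbert_fun n I d = scheme_deg n I"
    unfolding reg_index_def by (rule LeastI_ex)
  then show "d \<ge> reg_index n I \<Longrightarrow> hilbert_fun n I d = scheme_deg n I" by blast
qed

text \<open>Multiplication by \<open>x\<^sub>0\<close> embeds each graded piece into the next; from
  the regularity index on both have the same finite dimension, so the embedding is onto.\<close>

lemma rpart_Suc_reg_index:
  assumes "d \<ge> reg_index n I"
  shows "rpart n I (Suc d) = (\<otimes>\<^bsub>R\<^esub>) (x 0) ` rpart n I d"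
proof -
  have "hilbert_fun n I (Suc d) = hilbert_fun n I d"
    using hilbert_fun_reg_index[of d] hilbert_fun_reg_index[of "Suc d"] assms by simp
  then have "R.dimension (hilbert_fun n I (Suc d)) K ((\<otimes>\<^bsub>R\<^esub>) (x 0) ` rpart n I d)"
    using x0_rpart_dimension[of d] by simp
  then show ?thesis using R.dimension_subset_eq[OF K_subfield rpart_dimension _ x0_rpart] by simp
qed

end

section \<open>The Euler form and the Koszul submodule\<close>

context zero_dim_off_hyperplane
begin

section \<open>The module of differentials of \<open>R\<close> over \<open>K\<close>\<close>

abbreviation "M \<equiv> Omega n I"
abbreviation "dd \<equiv> kaehler_d R K"
abbreviation "dx \<equiv> dvar n I"
abbreviation "\<epsilon> \<equiv> euler_form n I"
abbreviation "U \<equiv> koszul n I"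

lemma kaehler_ring_R: "kaehler_ring R K"
  by (intro kaehler_ring.intro R.cring_axioms kaehler_ring_axioms.intro K_carrier)

lemma module_Omega: "module R M"
proof -
  interpret kaehler_ring R K by (rule kaehler_ring_R)
  show ?thesis unfolding Omega_def by (rule \<Omega>.module_axioms)
qed

sublocale M: module R M
  by (rule module_Omega)

lemma dd_simps:
  "r \<in> carrier R \<Longrightarrow> dd r \<in> carrier M"
  "r \<in> carrier R \<Longrightarrow> s \<in> carrier R \<Longrightarrow> dd (r \<oplus>\<^bsub>R\<^esub> s) = dd r \<oplus>\<^bsub>M\<^esub> dd s"
  "r \<in> carrier R \<Longrightarrow> s \<in> carrier R \<Longrightarrow>
    dd (r \<otimes>\<^bsub>R\<^esub> s) = r \<odot>\<^bsub>M\<^esub> dd s \<oplus>\<^bsub>M\<^esub> s \<odot>\<^bsub>M\<^esub> dd r"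
  "a \<in> K \<Longrightarrow> dd a = \<zero>\<^bsub>M\<^esub>" "dd \<zero>\<^bsub>R\<^esub> = \<zero>\<^bsub>M\<^esub>"
proof -
  interpret kaehler_ring R K by (rule kaehler_ring_R)
  show "r \<in> carrier R \<Longrightarrow> dd r \<in> carrier M"
    "r \<in> carrier R \<Longrightarrow> s \<in> carrier R \<Longrightarrow> dd (r \<oplus>\<^bsub>R\<^esub> s) = dd r \<oplus>\<^bsub>M\<^esub> dd s"
    "r \<in> carrier R \<Longrightarrow> s \<in> carrier R \<Longrightarrow>
      dd (r \<otimes>\<^bsub>R\<^esub> s) = r \<odot>\<^bsub>M\<^esub> dd s \<oplus>\<^bsub>M\<^esub> s \<odot>\<^bsub>M\<^esub> dd r"
    "a \<in> K \<Longrightarrow> dd a = \<zero>\<^bsub>M\<^esub>" "dd \<zero>\<^bsub>R\<^esub> = \<zero>\<^bsub>M\<^esub>"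
    unfolding Omega_def by (rule d_closed d_add d_mult d_const d_zero; assumption?)+
qed

lemma dx_eq: "dx j = dd (x j)"
  by (simp add: dvar_def)

lemma dx_carrier [simp, intro]: "j \<le> n \<Longrightarrow> dx j \<in> carrier M"
  by (simp add: dx_eq dd_simps)

text \<open>The differentials of all ring elements generate, and by the Leibniz rule the
  differential of a polynomial expression is a combination of the \<open>dx\<^sub>j\<close>.\<close>

lemma Omega_generated_dx:
  assumes T: "submodule T R M" and dx: "\<And>j. j \<le> n \<Longrightarrow> dx j \<in> T" and w: "w \<in> carrier M"
  shows "w \<in> T"
proof -
  interpret Om: kaehler_ring R K by (rule kaehler_ring_R)
  have poly: "dd (cl f) \<in> T" if "f \<in> pcarrier n" for f
    using that
  proof (induction rule: pcarrier_induct)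
    case (const c)
    have "cl (pconst c) \<in> K" by (simp add: rscalars_def)
    then show ?case using M.submodule_zero[OF T] by (simp add: dd_simps(4))
  next
    case (var j)
    then show ?case using dx by (simp add: dx_eq rvar_def)
  next
    case (add f g)
    then show ?case using M.submoduleE(5)[OF T] by (simp add: dd_simps)
  next
    case (mult f g)
    have "cl f \<odot>\<^bsub>M\<^esub> dd (cl g) \<in> T" "cl g \<odot>\<^bsub>M\<^esub> dd (cl f) \<in> T"
      using mult by (auto intro!: M.submoduleE(4)[OF T])
    then show ?case using mult M.submoduleE(5)[OF T] by (simp add: dd_simps)
  qed
  show ?thesis
  proof (rule Om.kaehler_generated)
    show "submodule T R (kaehler R K)" using T by (simp add: Omega_def)
    show "w \<in> carrier (kaehler R K)" using w by (simp add: Omega_def)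
    show "dd r \<in> T" if "r \<in> carrier R" for r
      using that poly by (auto simp: R_carrier)
  qed
qed

section \<open>The Euler derivation on \<open>R\<close> and the Euler form\<close>

definition delta :: "'k mpoly set \<Rightarrow> 'k mpoly set" where
  "delta X = cl (euler_op (SOME f. f \<in> pcarrier n \<and> cl f = X))"

text \<open>\<open>delta\<close> uses an arbitrary representative; another choice changes the result
  by \<open>euler_op\<close> of an element of \<open>I\<close>, which is again in
  \<open>I\<close>.\<close>

lemma delta_cl:
  assumes f: "f \<in> pcarrier n" shows "delta (cl f) = cl (euler_op f)"
proof -
  define g where "g = (SOME g. g \<in> pcarrier n \<and> cl g = cl f)"
  have g: "g \<in> pcarrier n \<and> cl g = cl f" unfolding g_def by (rule someI[of _ f]) (use f in simp)
  then have "g - f \<in> I" using f cl_eq_iff[of g f] by simp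
  then have "euler_op (g - f) \<in> I" by (rule euler_op_homogeneous_ideal[OF I_homogeneous])
  moreover have "euler_op g = euler_op (g - f) + euler_op f" by (simp flip: euler_op_add)
  ultimately have "euler_op g - euler_op f \<in> I" by simp
  then show ?thesis using g f cl_eq_iff[of "euler_op g" "euler_op f"]
    by (simp add: delta_def flip: g_def)
qed

lemma delta_carrier: "a \<in> carrier R \<Longrightarrow> delta a \<in> carrier R"
  by (auto simp: R_carrier delta_cl)

text \<open>Existence comes from the universal property applied to \<open>delta\<close>, uniqueness
  from the generators \<open>dx\<^sub>j\<close>. This identifies the map described by
  \<open>THE\<close> and makes its properties available.\<close>

lemma
  shows euler_form_linear: "linear_map R M \<epsilon>"
    and euler_form_dx: "\<And>j. j \<le> n \<Longrightarrow> \<epsilon> (dx j) = x j"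
    and euler_form_dd: "\<And>a. a \<in> carrier R \<Longrightarrow> \<epsilon> (dd a) = delta a"
proof -
  interpret Om: kaehler_ring R K by (rule kaehler_ring_R)
  have "\<exists>h. linear_map R (kaehler R K) h \<and> (\<forall>a\<in>carrier R. h (dd a) = delta a)"
  proof (rule Om.kaehler_universal[of delta])
    show "delta \<in> carrier R \<rightarrow> carrier R" using delta_carrier by blast
    show "delta (r \<oplus>\<^bsub>R\<^esub> s) = delta r \<oplus>\<^bsub>R\<^esub> delta s" if rs: "r \<in> carrier R" "s \<in> carrier R" for r s
    proof -
      obtain f g where fg: "f \<in> pcarrier n" "r = cl f" "g \<in> pcarrier n" "s = cl g"
        using rs by (auto simp: R_carrier)
      have "delta (cl (f + g)) = delta r \<oplus>\<^bsub>R\<^esub> delta s"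
        using fg by (subst delta_cl) (auto simp: euler_op_add delta_cl)
      then show ?thesis using fg by simp
    qed
    show "delta (r \<otimes>\<^bsub>R\<^esub> s) = r \<otimes>\<^bsub>R\<^esub> delta s \<oplus>\<^bsub>R\<^esub> s \<otimes>\<^bsub>R\<^esub> delta r"
      if rs: "r \<in> carrier R" "s \<in> carrier R" for r s
    proof -
      obtain f g where fg: "f \<in> pcarrier n" "r = cl f" "g \<in> pcarrier n" "s = cl g"
        using rs by (auto simp: R_carrier)
      have "delta (cl (f * g)) = r \<otimes>\<^bsub>R\<^esub> delta s \<oplus>\<^bsub>R\<^esub> s \<otimes>\<^bsub>R\<^esub> delta r"
        using fg by (subst delta_cl) (auto simp: euler_op_mult[of f n] delta_cl)
      then show ?thesis using fg by simp
    qed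
    show "delta a = \<zero>\<^bsub>R\<^esub>" if a: "a \<in> K" for a
    proof -
      obtain c where c: "a = cl (pconst c)" using a by (auto simp: rscalars_def)
      have "euler_op (pconst c) = 0" using euler_op_homog[of 0 "pconst c"] by simp
      then show ?thesis by (simp add: c delta_cl)
    qed
  qed blast
  then obtain h where h: "linear_map R M h" and hd: "\<And>a. a \<in> carrier R \<Longrightarrow> h (dd a) = delta a"
    by (auto simp: Omega_def)
  have hx: "h (dx j) = x j" if j: "j \<le> n" for j
  proof -
    have "h (dx j) = cl (euler_op (pvar j))" using j by (simp add: dx_eq hd rvar_def delta_cl)
    then show ?thesis using euler_op_homog[of 1 "pvar j :: 'k mpoly"] by (simp add: rvar_def)
  qed
  \<comment> \<open>Restriction makes the map extensional, as the description of
    \<open>euler_form\<close> demands.\<close>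
  let ?h = "restrict h (carrier M)"
  have h': "linear_map R M ?h"
    unfolding linear_map_def using h by (auto simp: linear_map_def)
  have h'x: "?h (dx j) = x j" if "j \<le> n" for j using that hx by simp
  have img: "?h ` carrier M = max_ideal n I"
  proof
    have xs: "x ` {..n} \<subseteq> carrier R" by auto
    have id: "ideal (max_ideal n I) R"
      unfolding max_ideal_def by (rule R.genideal_ideal[OF xs])
    have "w \<in> {w \<in> carrier M. ?h w \<in> max_ideal n I}" if w: "w \<in> carrier M" for w
    proof (rule Omega_generated_dx[OF M.submodule_linear_preimage[OF h' id] _ w])
      fix j assume j: "j \<le> n"
      then have "x j \<in> max_ideal n I"
        unfolding max_ideal_def by (intro subsetD[OF R.genideal_self[OF xs]]) simp
      then show "dx j \<in> {w \<in> carrier M. ?h w \<in> max_ideal n I}"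
        using j h'x[OF j] by simp
    qed
    then show "?h ` carrier M \<subseteq> max_ideal n I" by blast
    \<comment> \<open>The image is an ideal, so containing the generators \<open>x j\<close> is
      enough for the reverse inclusion.\<close>
    have "x j \<in> ?h ` carrier M" if j: "j \<le> n" for j
      using h'x[OF j] dx_carrier[OF j] by (metis imageI)
    then show "max_ideal n I \<subseteq> ?h ` carrier M"
      unfolding max_ideal_def by (intro R.genideal_minimal M.ideal_linear_image[OF h']) blast
  qed
  have "\<epsilon> = ?h"
    unfolding euler_form_def
  proof (rule the_equality)
    show "?h \<in> extensional (carrier M) \<and> linear_map R M ?h \<and> ?h ` carrier M = max_ideal n I \<and>
        (\<forall>j\<le>n. ?h (dx j) = x j)"
      using h' img h'x by simp
    fix g assume g: "g \<in> extensional (carrier M) \<and> linear_map R M g \<and>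
      g ` carrier M = max_ideal n I \<and> (\<forall>j\<le>n. g (dx j) = x j)"
    then have lin: "linear_map R M g" and gx: "\<And>j. j \<le> n \<Longrightarrow> g (dx j) = x j" by simp_all
    show "g = ?h"
    proof (rule extensionalityI[of _ "carrier M"])
      show "g w = ?h w" if w: "w \<in> carrier M" for w
        using Omega_generated_dx[OF M.submodule_linear_equalizer[OF lin h'] _ w] gx h'x by simp
    qed (use g in simp_all)
  qed
  then show "linear_map R M \<epsilon>" "\<And>j. j \<le> n \<Longrightarrow> \<epsilon> (dx j) = x j"
    "\<And>a. a \<in> carrier R \<Longrightarrow> \<epsilon> (dd a) = delta a"
    using h' h'x hd dd_simps(1) by simp_all
qed

lemmas \<epsilon>_D = M.linear_mapD[OF euler_form_linear]

lemma euler_kernel_eq: "euler_kernel n I = {w \<in> carrier M. \<epsilon> w = \<zero>\<^bsub>R\<^esub>}"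
  by (simp add: euler_kernel_def a_kernel_def')

section \<open>The Koszul submodule and congruences modulo it\<close>

lemma koszul_gen_carrier:
  "{x i \<odot>\<^bsub>M\<^esub> dx j \<ominus>\<^bsub>M\<^esub> x j \<odot>\<^bsub>M\<^esub> dx i | i j. i < j \<and> j \<le> n} \<subseteq> carrier M"
  by auto

lemma koszul_submodule: "submodule U R M"
  unfolding koszul_def by (rule M.submod_gen_submodule[OF koszul_gen_carrier])

lemmas U_D = M.submoduleE[OF koszul_submodule] M.submodule_zero[OF koszul_submodule]

text \<open>For \<open>i = j\<close> the element is zero and for \<open>j < i\<close> it is the
  negative of a generator, so the order of the indices can be ignored from here on.\<close>

lemma koszul_gen:
  assumes "i \<le> n" "j \<le> n"
  shows "x i \<odot>\<^bsub>M\<^esub> dx j \<ominus>\<^bsub>M\<^esub> x j \<odot>\<^bsub>M\<^esub> dx i \<in> U"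
proof -
  have lt: "x i \<odot>\<^bsub>M\<^esub> dx j \<ominus>\<^bsub>M\<^esub> x j \<odot>\<^bsub>M\<^esub> dx i \<in> U" if "i < j" "j \<le> n" for i j
    unfolding koszul_def by (rule subsetD[OF submod_gen_incl]) (use that in blast)
  consider "i < j" | "i = j" | "j < i" by linarith
  then show ?thesis
  proof cases
    case 2
    then show ?thesis using assms U_D(7) by (simp add: a_minus_def M.M.r_neg)
  next
    case 3
    have "\<ominus>\<^bsub>M\<^esub> (x j \<odot>\<^bsub>M\<^esub> dx i \<ominus>\<^bsub>M\<^esub> x i \<odot>\<^bsub>M\<^esub> dx j) \<in> U" using lt[OF 3 assms(1)] by (rule U_D(3))
    moreover have "\<ominus>\<^bsub>M\<^esub> (x j \<odot>\<^bsub>M\<^esub> dx i \<ominus>\<^bsub>M\<^esub> x i \<odot>\<^bsub>M\<^esub> dx j) = x i \<odot>\<^bsub>M\<^esub> dx j \<ominus>\<^bsub>M\<^esub> x j \<odot>\<^bsub>M\<^esub> dx i"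
      using assms by (simp add: a_minus_def M.M.minus_add M.M.a_comm)
    ultimately show ?thesis by simp
  qed (use lt assms in blast)
qed

text \<open>On a generator the value of \<open>\<epsilon>\<close> vanishes by commutativity of
  \<open>R\<close>, and the kernel is a submodule.\<close>

lemma koszul_subset_kernel: "U \<subseteq> euler_kernel n I"
proof -
  have gen: "\<epsilon> (x i \<odot>\<^bsub>M\<^esub> dx j \<ominus>\<^bsub>M\<^esub> x j \<odot>\<^bsub>M\<^esub> dx i) = \<zero>\<^bsub>R\<^esub>" if "i < j" "j \<le> n" for i j
  proof -
    have "\<epsilon> (x i \<odot>\<^bsub>M\<^esub> dx j \<ominus>\<^bsub>M\<^esub> x j \<odot>\<^bsub>M\<^esub> dx i) = x i \<otimes>\<^bsub>R\<^esub> x j \<ominus>\<^bsub>R\<^esub> x j \<otimes>\<^bsub>R\<^esub> x i"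
      using that by (simp add: \<epsilon>_D euler_form_dx)
    then show ?thesis using that by (simp add: a_minus_def R.m_comm R.r_neg)
  qed
  have "submodule {w \<in> carrier M. \<epsilon> w \<in> {\<zero>\<^bsub>R\<^esub>}} R M"
    by (rule M.submodule_linear_preimage[OF euler_form_linear R.zeroideal])
  then have "U \<subseteq> {w \<in> carrier M. \<epsilon> w \<in> {\<zero>\<^bsub>R\<^esub>}}"
    unfolding koszul_def
    by (rule submod_gen_minimal[rotated]) (use koszul_gen_carrier gen in blast)
  then show ?thesis by (simp add: euler_kernel_eq)
qed

text \<open>For fixed \<open>j\<close> the elements \<open>w\<close> satisfying the congruence form
  a submodule. For \<open>w = dx k\<close> the difference is \<open>x j\<close> times
  \<open>dx k\<close> minus \<open>x k\<close> times \<open>dx j\<close>, which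
  \<open>koszul_gen\<close> covers.\<close>

lemma x_smult_congruent:
  assumes w: "w \<in> carrier M" and j: "j \<le> n"
  shows "x j \<odot>\<^bsub>M\<^esub> w \<ominus>\<^bsub>M\<^esub> \<epsilon> w \<odot>\<^bsub>M\<^esub> dx j \<in> U"
proof -
  let ?T = "{w \<in> carrier M. x j \<odot>\<^bsub>M\<^esub> w \<ominus>\<^bsub>M\<^esub> \<epsilon> w \<odot>\<^bsub>M\<^esub> dx j \<in> U}"
  have "submodule ?T R M"
  proof (rule M.submoduleI)
    show "\<zero>\<^bsub>M\<^esub> \<in> ?T" using j U_D(3)[OF U_D(7)] by (simp add: \<epsilon>_D a_minus_def)
    show "a \<oplus>\<^bsub>M\<^esub> b \<in> ?T" if "a \<in> ?T" "b \<in> ?T" for a b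
    proof -
      have ab: "a \<in> carrier M" "b \<in> carrier M" using that by simp_all
      then have "x j \<odot>\<^bsub>M\<^esub> (a \<oplus>\<^bsub>M\<^esub> b) \<ominus>\<^bsub>M\<^esub> \<epsilon> (a \<oplus>\<^bsub>M\<^esub> b) \<odot>\<^bsub>M\<^esub> dx j =
        (x j \<odot>\<^bsub>M\<^esub> a \<ominus>\<^bsub>M\<^esub> \<epsilon> a \<odot>\<^bsub>M\<^esub> dx j) \<oplus>\<^bsub>M\<^esub> (x j \<odot>\<^bsub>M\<^esub> b \<ominus>\<^bsub>M\<^esub> \<epsilon> b \<odot>\<^bsub>M\<^esub> dx j)"
        using j by (simp add: \<epsilon>_D M.smult_r_distr M.smult_l_distr M.add_diff_rearrange)
      then show ?thesis using that U_D(5) ab by simp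
    qed
    show sm: "r \<odot>\<^bsub>M\<^esub> a \<in> ?T" if r: "r \<in> carrier R" and a: "a \<in> ?T" for r a
    proof -
      have aM: "a \<in> carrier M" using a by simp
      then have "x j \<odot>\<^bsub>M\<^esub> (r \<odot>\<^bsub>M\<^esub> a) = r \<odot>\<^bsub>M\<^esub> (x j \<odot>\<^bsub>M\<^esub> a)"
        using j r by (simp add: R.m_comm flip: M.smult_assoc1)
      then have "x j \<odot>\<^bsub>M\<^esub> (r \<odot>\<^bsub>M\<^esub> a) \<ominus>\<^bsub>M\<^esub> \<epsilon> (r \<odot>\<^bsub>M\<^esub> a) \<odot>\<^bsub>M\<^esub> dx j =
        r \<odot>\<^bsub>M\<^esub> (x j \<odot>\<^bsub>M\<^esub> a \<ominus>\<^bsub>M\<^esub> \<epsilon> a \<odot>\<^bsub>M\<^esub> dx j)"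
        using j r aM by (simp add: \<epsilon>_D M.smult_assoc1 M.smult_r_distr M.smult_r_minus a_minus_def)
      then show ?thesis using a r U_D(4) by simp
    qed
    show "\<ominus>\<^bsub>M\<^esub> a \<in> ?T" if a: "a \<in> ?T" for a
      using sm[of "\<ominus>\<^bsub>R\<^esub> \<one>\<^bsub>R\<^esub>" a] a by (simp add: M.smult_l_minus)
  qed simp
  then have "w \<in> ?T"
    by (rule Omega_generated_dx[OF _ _ w]) (use j koszul_gen euler_form_dx in simp)
  then show ?thesis by simp
qed

text \<open>The congruence for index \<open>0\<close> gives one inclusion, since its second term
  vanishes on the kernel. For the other, \<open>x 0 \<otimes> \<epsilon> w\<close> is zero and
  \<open>x 0\<close> is a non-zerodivisor.\<close>

lemma kernel_iff_x0_smult: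
  "euler_kernel n I = {w \<in> carrier M. x 0 \<odot>\<^bsub>M\<^esub> w \<in> U}"
proof (intro equalityI subsetI)
  fix w assume "w \<in> euler_kernel n I"
  then have w: "w \<in> carrier M" "\<epsilon> w = \<zero>\<^bsub>R\<^esub>" by (simp_all add: euler_kernel_eq)
  then show "w \<in> {w \<in> carrier M. x 0 \<odot>\<^bsub>M\<^esub> w \<in> U}"
    using x_smult_congruent[OF w(1), of 0] M.M.minus_equality[of "\<zero>\<^bsub>M\<^esub>" "\<zero>\<^bsub>M\<^esub>"]
    by (simp add: a_minus_def)
next
  fix w assume w: "w \<in> {w \<in> carrier M. x 0 \<odot>\<^bsub>M\<^esub> w \<in> U}"
  then have "x 0 \<odot>\<^bsub>M\<^esub> w \<in> euler_kernel n I" using koszul_subset_kernel by blast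
  then have "x 0 \<otimes>\<^bsub>R\<^esub> \<epsilon> w = \<zero>\<^bsub>R\<^esub>" using w by (simp add: euler_kernel_eq \<epsilon>_D)
  then show "w \<in> euler_kernel n I" using w x0_nzd[of "\<epsilon> w"] by (simp add: euler_kernel_eq \<epsilon>_D)
qed

section \<open>Forms with polynomial coefficients, to which \<open>hcomp\<close> and
  \<open>euler_op\<close> apply\<close>

definition dform :: "(nat \<Rightarrow> 'k mpoly) \<Rightarrow> 'k diff" where
  "dform F = (\<Oplus>\<^bsub>M\<^esub>j\<in>{..n}. cl (F j) \<odot>\<^bsub>M\<^esub> dx j)"

lemma dform_closed [simp]: "(\<And>j. j \<le> n \<Longrightarrow> F j \<in> pcarrier n) \<Longrightarrow> dform F \<in> carrier M"
  unfolding dform_def by (intro M.M.finsum_closed) auto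

lemma dform_add:
  assumes "\<And>j. j \<le> n \<Longrightarrow> F j \<in> pcarrier n" "\<And>j. j \<le> n \<Longrightarrow> G j \<in> pcarrier n"
  shows "dform (\<lambda>j. F j + G j) = dform F \<oplus>\<^bsub>M\<^esub> dform G"
proof -
  have "dform (\<lambda>j. F j + G j) = (\<Oplus>\<^bsub>M\<^esub>j\<in>{..n}. cl (F j) \<odot>\<^bsub>M\<^esub> dx j \<oplus>\<^bsub>M\<^esub> cl (G j) \<odot>\<^bsub>M\<^esub> dx j)"
    unfolding dform_def using assms by (intro M.M.finsum_cong') (auto simp: M.smult_l_distr)
  also have "\<dots> = dform F \<oplus>\<^bsub>M\<^esub> dform G"
    unfolding dform_def using assms by (intro M.M.finsum_addf) auto
  finally show ?thesis .
qed

lemma dform_smult: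
  assumes "\<And>j. j \<le> n \<Longrightarrow> F j \<in> pcarrier n" "g \<in> pcarrier n"
  shows "dform (\<lambda>j. g * F j) = cl g \<odot>\<^bsub>M\<^esub> dform F"
proof -
  have "dform (\<lambda>j. g * F j) = (\<Oplus>\<^bsub>M\<^esub>j\<in>{..n}. cl g \<odot>\<^bsub>M\<^esub> (cl (F j) \<odot>\<^bsub>M\<^esub> dx j))"
    unfolding dform_def using assms by (intro M.M.finsum_cong') (auto simp: M.smult_assoc1)
  also have "\<dots> = cl g \<odot>\<^bsub>M\<^esub> dform F"
    unfolding dform_def using assms by (intro M.finsum_smult_ldistr[symmetric]) auto
  finally show ?thesis .
qed

lemma dform_zero: "dform (\<lambda>_. 0) = \<zero>\<^bsub>M\<^esub>"
  using dform_smult[of "\<lambda>_. 0" 0] by simp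

text \<open>Forms of this shape make up a submodule containing each \<open>dx i\<close>, whose
  coefficients are \<open>1\<close> at \<open>i\<close> and \<open>0\<close> elsewhere.\<close>

lemma dform_surj:
  assumes w: "w \<in> carrier M"
  obtains F where "\<And>j. F j \<in> pcarrier n" "w = dform F"
proof -
  let ?T = "{dform F | F. \<forall>j. F j \<in> pcarrier n}"
  have "submodule ?T R M"
  proof (rule M.submoduleI)
    show "?T \<subseteq> carrier M" by auto
    have "\<exists>F. \<zero>\<^bsub>M\<^esub> = dform F \<and> (\<forall>j. F j \<in> pcarrier n)"
      by (rule exI[of _ "\<lambda>_. 0"]) (simp add: dform_zero)
    then show "\<zero>\<^bsub>M\<^esub> \<in> ?T" by simp
    show "a \<oplus>\<^bsub>M\<^esub> b \<in> ?T" if ab: "a \<in> ?T" "b \<in> ?T" for a b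
    proof -
      obtain F G where "\<forall>j. F j \<in> pcarrier n" "a = dform F" "\<forall>j. G j \<in> pcarrier n" "b = dform G"
        using ab by blast
      then have "a \<oplus>\<^bsub>M\<^esub> b = dform (\<lambda>j. F j + G j) \<and> (\<forall>j. F j + G j \<in> pcarrier n)"
        by (simp add: dform_add)
      then show ?thesis by blast
    qed
    show sm: "r \<odot>\<^bsub>M\<^esub> a \<in> ?T" if r: "r \<in> carrier R" and a: "a \<in> ?T" for r a
    proof -
      obtain F g where "\<forall>j. F j \<in> pcarrier n" "a = dform F" "g \<in> pcarrier n" "r = cl g"
        using r a by (auto simp: R_carrier)
      then have "r \<odot>\<^bsub>M\<^esub> a = dform (\<lambda>j. g * F j) \<and> (\<forall>j. g * F j \<in> pcarrier n)"
        by (simp add: dform_smult)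
      then show ?thesis by blast
    qed
    show "\<ominus>\<^bsub>M\<^esub> a \<in> ?T" if a: "a \<in> ?T" for a
    proof -
      have "a \<in> carrier M" using a by auto
      then show ?thesis using sm[of "\<ominus>\<^bsub>R\<^esub> \<one>\<^bsub>R\<^esub>" a] a by (simp add: M.smult_l_minus)
    qed
  qed
  moreover have "dx i \<in> ?T" if i: "i \<le> n" for i
  proof -
    let ?F = "\<lambda>j. if j = i then 1 else 0"
    have "dform ?F = (\<Oplus>\<^bsub>M\<^esub>j\<in>{..n}. if i = j then dx j else \<zero>\<^bsub>M\<^esub>)"
      unfolding dform_def by (intro M.M.finsum_cong') auto
    also have "\<dots> = dx i" using i by (intro M.M.add.finprod_singleton) auto
    finally have "dx i = dform ?F \<and> (\<forall>j. ?F j \<in> pcarrier n)" by simp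
    then show ?thesis by blast
  qed
  ultimately have "w \<in> ?T" using w by (rule Omega_generated_dx)
  then show thesis using that by blast
qed

text \<open>Each coefficient class is replaced by a homogeneous polynomial representing it. The
  degree of the form exceeds that of its coefficients by one, because \<open>dx\<^sub>j\<close> has
  degree \<open>1\<close>.\<close>

lemma omega_part_Suc:
  "omega_part n I (Suc d) = {dform F | F. \<forall>j\<le>n. F j \<in> ppart n d}"
proof (intro equalityI subsetI)
  fix w assume "w \<in> omega_part n I (Suc d)"
  then obtain f where f: "\<And>j. j \<le> n \<Longrightarrow> f j \<in> rpart n I d" "w = (\<Oplus>\<^bsub>M\<^esub>j\<in>{..n}. f j \<odot>\<^bsub>M\<^esub> dx j)"
    by (auto simp: omega_part_def)
  have "\<forall>j. \<exists>g. j \<le> n \<longrightarrow> g \<in> ppart n d \<and> f j = cl g" using f(1) by (auto simp: rpart_def)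
  then obtain F where F: "\<And>j. j \<le> n \<Longrightarrow> F j \<in> ppart n d \<and> f j = cl (F j)" by metis
  then have "w = dform F"
    unfolding f(2) dform_def by (intro M.M.finsum_cong') (auto simp: ppart_iff)
  then show "w \<in> {dform F | F. \<forall>j\<le>n. F j \<in> ppart n d}" using F by blast
next
  fix w assume "w \<in> {dform F | F. \<forall>j\<le>n. F j \<in> ppart n d}"
  then obtain F where F: "\<forall>j\<le>n. F j \<in> ppart n d" "w = dform F" by blast
  then have "\<forall>j\<le>n. cl (F j) \<in> rpart n I d" by (auto simp: rpart_def)
  then show "w \<in> omega_part n I (Suc d)"
    unfolding omega_part_def F(2) dform_def
    by (simp, intro exI[of _ "\<lambda>j. cl (F j)"], simp)
qed

lemma euler_form_sum_dx:
  assumes F: "\<And>j. j \<le> n \<Longrightarrow> F j \<in> pcarrier n" and A: "finite A" "A \<subseteq> {..n}"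
  shows "\<epsilon> (\<Oplus>\<^bsub>M\<^esub>j\<in>A. cl (F j) \<odot>\<^bsub>M\<^esub> dx j) = cl (\<Sum>j\<in>A. F j * pvar j)"
  using A
proof (induction A)
  case empty
  then show ?case by (simp add: \<epsilon>_D)
next
  case (insert i A)
  have i: "i \<le> n" "F i \<in> pcarrier n" using insert F by auto
  have fA: "(\<lambda>j. cl (F j) \<odot>\<^bsub>M\<^esub> dx j) \<in> A \<rightarrow> carrier M" using insert F by auto
  have S: "(\<Sum>j\<in>A. F j * pvar j) \<in> pcarrier n" by (rule pcarrier_sum) (use insert F in auto)
  show ?case using insert i fA S
    by (simp add: \<epsilon>_D euler_form_dx M.M.finsum_closed rvar_def)
qed

text \<open>By the Leibniz rule \<open>d(F\<^sub>j x\<^sub>j) = F\<^sub>j dx\<^sub>j + x\<^sub>j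
  dF\<^sub>j\<close>. Modulo the Koszul submodule the second term is
  \<open>\<epsilon>(dF\<^sub>j) dx\<^sub>j\<close>, where \<open>\<epsilon>(dF\<^sub>j)\<close> is
  the class of \<open>euler_op (F j)\<close>.\<close>

lemma d_sum_congruent_koszul:
  assumes F: "\<And>j. j \<le> n \<Longrightarrow> F j \<in> pcarrier n" and A: "finite A" "A \<subseteq> {..n}"
  shows "dd (cl (\<Sum>j\<in>A. F j * pvar j)) \<ominus>\<^bsub>M\<^esub>
    ((\<Oplus>\<^bsub>M\<^esub>j\<in>A. cl (F j) \<odot>\<^bsub>M\<^esub> dx j) \<oplus>\<^bsub>M\<^esub> (\<Oplus>\<^bsub>M\<^esub>j\<in>A. cl (euler_op (F j)) \<odot>\<^bsub>M\<^esub> dx j)) \<in> U"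
  using A
proof (induction A)
  case empty
  then show ?case using U_D(7) by (simp add: dd_simps a_minus_def M.M.r_neg)
next
  case (insert i A)
  have i: "i \<le> n" "F i \<in> pcarrier n" using insert F by auto
  have fA: "(\<lambda>j. cl (F j) \<odot>\<^bsub>M\<^esub> dx j) \<in> A \<rightarrow> carrier M"
    "(\<lambda>j. cl (euler_op (F j)) \<odot>\<^bsub>M\<^esub> dx j) \<in> A \<rightarrow> carrier M" using insert F by auto
  have S: "(\<Sum>j\<in>A. F j * pvar j) \<in> pcarrier n" by (rule pcarrier_sum) (use insert F in auto)
  define s where "s = dd (cl (\<Sum>j\<in>A. F j * pvar j))"
  define u where "u = (\<Oplus>\<^bsub>M\<^esub>j\<in>A. cl (F j) \<odot>\<^bsub>M\<^esub> dx j)"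
  define v where "v = (\<Oplus>\<^bsub>M\<^esub>j\<in>A. cl (euler_op (F j)) \<odot>\<^bsub>M\<^esub> dx j)"
  define a where "a = cl (F i) \<odot>\<^bsub>M\<^esub> dx i"
  define b where "b = x i \<odot>\<^bsub>M\<^esub> dd (cl (F i))"
  define c where "c = cl (euler_op (F i)) \<odot>\<^bsub>M\<^esub> dx i"
  have car: "s \<in> carrier M" "u \<in> carrier M" "v \<in> carrier M" "a \<in> carrier M" "b \<in> carrier M"
    "c \<in> carrier M"
    unfolding s_def u_def v_def a_def b_def c_def
    using S i fA by (simp_all add: dd_simps M.M.finsum_closed)
  \<comment> \<open>The basic congruence, applied to the differential of \<open>cl (F i)\<close>,
    replaces \<open>b\<close> by the Euler term \<open>c\<close>.\<close>
  have "b \<ominus>\<^bsub>M\<^esub> c \<in> U"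
    using x_smult_congruent[of "dd (cl (F i))" i] i
    by (simp add: b_def c_def dd_simps euler_form_dd delta_cl)
  moreover have "s \<ominus>\<^bsub>M\<^esub> (u \<oplus>\<^bsub>M\<^esub> v) \<in> U"
    using insert by (simp add: s_def u_def v_def)
  ultimately have "(b \<ominus>\<^bsub>M\<^esub> c) \<oplus>\<^bsub>M\<^esub> (s \<ominus>\<^bsub>M\<^esub> (u \<oplus>\<^bsub>M\<^esub> v)) \<in> U" by (rule U_D(5))
  \<comment> \<open>Adding \<open>a\<close> minus \<open>a\<close> supplies the term
    \<open>F\<^sub>i dx\<^sub>i\<close>, which occurs on both sides of the congruence.\<close>
  also have "(b \<ominus>\<^bsub>M\<^esub> c) \<oplus>\<^bsub>M\<^esub> (s \<ominus>\<^bsub>M\<^esub> (u \<oplus>\<^bsub>M\<^esub> v)) =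
      (a \<ominus>\<^bsub>M\<^esub> a) \<oplus>\<^bsub>M\<^esub> ((b \<ominus>\<^bsub>M\<^esub> c) \<oplus>\<^bsub>M\<^esub> (s \<ominus>\<^bsub>M\<^esub> (u \<oplus>\<^bsub>M\<^esub> v)))"
    using car by (simp add: a_minus_def M.M.r_neg)
  also have "\<dots> = (a \<oplus>\<^bsub>M\<^esub> (b \<oplus>\<^bsub>M\<^esub> s)) \<ominus>\<^bsub>M\<^esub> (a \<oplus>\<^bsub>M\<^esub> (c \<oplus>\<^bsub>M\<^esub> (u \<oplus>\<^bsub>M\<^esub> v)))"
    using car by (simp add: M.M.add_diff_rearrange)
  also have "a \<oplus>\<^bsub>M\<^esub> (c \<oplus>\<^bsub>M\<^esub> (u \<oplus>\<^bsub>M\<^esub> v)) = (a \<oplus>\<^bsub>M\<^esub> u) \<oplus>\<^bsub>M\<^esub> (c \<oplus>\<^bsub>M\<^esub> v)"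
    using car by (simp add: M.M.a_ac)
  also have "a \<oplus>\<^bsub>M\<^esub> (b \<oplus>\<^bsub>M\<^esub> s) = dd (cl (\<Sum>j\<in>insert i A. F j * pvar j))"
    using insert i S by (simp add: a_def b_def s_def dd_simps rvar_def dx_eq M.M.a_assoc)
  also have "a \<oplus>\<^bsub>M\<^esub> u = (\<Oplus>\<^bsub>M\<^esub>j\<in>insert i A. cl (F j) \<odot>\<^bsub>M\<^esub> dx j)"
    using insert i fA by (simp add: a_def u_def)
  also have "c \<oplus>\<^bsub>M\<^esub> v = (\<Oplus>\<^bsub>M\<^esub>j\<in>insert i A. cl (euler_op (F j)) \<odot>\<^bsub>M\<^esub> dx j)"
    using insert i fA by (simp add: c_def v_def)
  finally show ?case .
qed

section \<open>Elements of the kernel, degree by degree\<close>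

lemma euler_form_dform:
  assumes "\<And>j. j \<le> n \<Longrightarrow> F j \<in> pcarrier n"
  shows "\<epsilon> (dform F) = cl (\<Sum>j\<le>n. F j * pvar j)"
  unfolding dform_def using euler_form_sum_dx[of F "{..n}"] assms by simp

lemma sum_mult_pvar_carrier:
  assumes "\<And>j. j \<le> n \<Longrightarrow> F j \<in> pcarrier n"
  shows "(\<Sum>j\<le>n. F j * pvar j) \<in> pcarrier n"
  by (rule pcarrier_sum) (use assms in auto)

lemma dform_in_kernel_iff:
  assumes F: "\<And>j. j \<le> n \<Longrightarrow> F j \<in> pcarrier n"
  shows "dform F \<in> euler_kernel n I \<longleftrightarrow> (\<Sum>j\<le>n. F j * pvar j) \<in> I"
  using F euler_form_dform[OF F] cl_zero_iff[OF sum_mult_pvar_carrier[OF F]]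
  by (simp add: euler_kernel_eq)

text \<open>For a form in the kernel the class of \<open>\<Sum>\<^sub>j F\<^sub>j X\<^sub>j\<close>
  is zero, hence so is its differential, and \<open>d_sum_congruent_koszul\<close> loses its first
  term.\<close>

lemma dform_add_euler_op:
  assumes F: "\<And>j. j \<le> n \<Longrightarrow> F j \<in> pcarrier n" and ker: "dform F \<in> euler_kernel n I"
  shows "dform F \<oplus>\<^bsub>M\<^esub> dform (\<lambda>j. euler_op (F j)) \<in> U"
proof -
  let ?w = "dform F \<oplus>\<^bsub>M\<^esub> dform (\<lambda>j. euler_op (F j))"
  have w: "?w \<in> carrier M" using F by simp
  have "cl (\<Sum>j\<le>n. F j * pvar j) = \<zero>\<^bsub>R\<^esub>"
    using ker euler_form_dform[OF F] by (simp add: euler_kernel_eq)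
  then have "\<zero>\<^bsub>M\<^esub> \<ominus>\<^bsub>M\<^esub> ?w \<in> U"
    using d_sum_congruent_koszul[of F "{..n}"] F by (simp add: dd_simps dform_def)
  then have "\<ominus>\<^bsub>M\<^esub> ?w \<in> U" using w by (simp add: a_minus_def)
  then have "\<ominus>\<^bsub>M\<^esub> (\<ominus>\<^bsub>M\<^esub> ?w) \<in> U" by (rule U_D(3))
  then show ?thesis by (simp only: M.M.minus_minus[OF w])
qed

text \<open>With coefficients of degree \<open>d\<close>, \<open>F j + euler_op (F j)\<close> is
  \<open>d + 1\<close> times \<open>F j\<close>, and \<open>d + 1\<close>, the degree of the form,
  is invertible in the field.\<close>

lemma homogeneous_kernel_in_koszul_char:
  assumes F: "\<And>j. j \<le> n \<Longrightarrow> F j \<in> ppart n d" and ker: "dform F \<in> euler_kernel n I"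
    and char: "of_nat (Suc d) \<noteq> (0 :: 'k)"
  shows "dform F \<in> U"
proof -
  have FP: "\<And>j. j \<le> n \<Longrightarrow> F j \<in> pcarrier n" and Fh: "\<And>j. j \<le> n \<Longrightarrow> homog d (F j)"
    using F by (auto simp: ppart_iff)
  let ?c = "of_nat (Suc d) :: 'k"
  have "dform F \<oplus>\<^bsub>M\<^esub> dform (\<lambda>j. euler_op (F j)) = dform (\<lambda>j. F j + euler_op (F j))"
    using FP by (simp add: dform_add)
  also have "\<dots> = dform (\<lambda>j. pconst ?c * F j)"
    unfolding dform_def
  proof (intro M.M.finsum_cong' refl)
    fix j assume "j \<in> {..n}"
    then have "F j + euler_op (F j) = of_nat (Suc d) * F j"
      using euler_op_homog[OF Fh, of j] by (simp add: algebra_simps)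
    then have "F j + euler_op (F j) = pconst ?c * F j" by (simp only: pconst_def single_of_nat)
    then show "cl (F j + euler_op (F j)) \<odot>\<^bsub>M\<^esub> dx j = cl (pconst ?c * F j) \<odot>\<^bsub>M\<^esub> dx j" by simp
  qed (use FP in auto)
  finally have "dform (\<lambda>j. pconst ?c * F j) \<in> U" using dform_add_euler_op[OF FP ker] by simp
  \<comment> \<open>Division by \<open>d + 1\<close> is scalar multiplication by the class of the
    constant \<open>1 / ?c\<close>.\<close>
  then have "cl (pconst (1 / ?c)) \<odot>\<^bsub>M\<^esub> dform (\<lambda>j. pconst ?c * F j) \<in> U" by (intro U_D(4)) simp_all
  moreover have "cl (pconst (1 / ?c)) \<odot>\<^bsub>M\<^esub> dform (\<lambda>j. pconst ?c * F j) =
      dform (\<lambda>j. pconst (1 / ?c) * (pconst ?c * F j))"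
    using FP by (intro dform_smult[symmetric]) auto
  moreover have "(\<lambda>j. pconst (1 / ?c) * (pconst ?c * F j)) = F"
  proof -
    have "pconst (1 / ?c) * pconst ?c = (1 :: 'k mpoly)"
      using char by (simp add: pconst_def mult_single del: of_nat_Suc single_of_nat)
    then show ?thesis by (simp flip: mult.assoc del: of_nat_Suc)
  qed
  ultimately show ?thesis by (simp only:)
qed

text \<open>The coefficients have degree \<open>d + 1\<close>, so each is \<open>x\<^sub>0\<close>
  times a class of degree \<open>d\<close>. The form is then \<open>x\<^sub>0\<close> times another
  one, which lies in the kernel because \<open>x\<^sub>0\<close> is a non-zerodivisor, and
  \<open>kernel_iff_x0_smult\<close> applies.\<close>

lemma homogeneous_kernel_in_koszul_reg:
  assumes F: "\<And>j. j \<le> n \<Longrightarrow> F j \<in> ppart n (Suc d)" and ker: "dform F \<in> euler_kernel n I"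
    and d: "d \<ge> reg_index n I"
  shows "dform F \<in> U"
proof -
  have "\<forall>j. \<exists>g. j \<le> n \<longrightarrow> g \<in> ppart n d \<and> cl (F j) = x 0 \<otimes>\<^bsub>R\<^esub> cl g"
  proof
    fix j
    have "cl (F j) \<in> (\<otimes>\<^bsub>R\<^esub>) (x 0) ` rpart n I d" if "j \<le> n"
      using F[OF that] rpart_Suc_reg_index[OF d] by (auto simp: rpart_def)
    then show "\<exists>g. j \<le> n \<longrightarrow> g \<in> ppart n d \<and> cl (F j) = x 0 \<otimes>\<^bsub>R\<^esub> cl g" by (auto simp: rpart_def)
  qed
  then obtain G where G: "\<And>j. j \<le> n \<Longrightarrow> G j \<in> ppart n d \<and> cl (F j) = x 0 \<otimes>\<^bsub>R\<^esub> cl (G j)" by metis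
  have GP: "\<And>j. j \<le> n \<Longrightarrow> G j \<in> pcarrier n" using G by (auto simp: ppart_iff)
  have "dform F = (\<Oplus>\<^bsub>M\<^esub>j\<in>{..n}. cl (pvar 0 * G j) \<odot>\<^bsub>M\<^esub> dx j)"
    unfolding dform_def using G GP by (intro M.M.finsum_cong') (auto simp: rvar_def)
  also have "\<dots> = x 0 \<odot>\<^bsub>M\<^esub> dform G"
    using dform_smult[of G "pvar 0"] GP by (simp add: dform_def rvar_def)
  finally have eq: "dform F = x 0 \<odot>\<^bsub>M\<^esub> dform G" .
  have "x 0 \<otimes>\<^bsub>R\<^esub> \<epsilon> (dform G) = \<zero>\<^bsub>R\<^esub>"
    using ker GP by (simp add: euler_kernel_eq eq \<epsilon>_D)
  then have "dform G \<in> euler_kernel n I"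
    using x0_nzd[of "\<epsilon> (dform G)"] GP by (simp add: euler_kernel_eq \<epsilon>_D)
  then show ?thesis using kernel_iff_x0_smult eq by simp
qed

lemma kernel_omega_part_Suc:
  assumes w: "w \<in> euler_kernel n I" "w \<in> omega_part n I (Suc d)"
    and d: "of_nat (Suc d) \<noteq> (0 :: 'k) \<or> Suc d \<ge> reg_index n I + 2"
  shows "w \<in> U"
proof -
  obtain F where F: "\<And>j. j \<le> n \<Longrightarrow> F j \<in> ppart n d" "w = dform F"
    using w(2) by (auto simp: omega_part_Suc)
  show ?thesis
  proof (cases "of_nat (Suc d) = (0 :: 'k)")
    case False
    then show ?thesis using homogeneous_kernel_in_koszul_char[of F d] F w(1) by simp
  next
    case True
    \<comment> \<open>The form has degree \<open>e + 2\<close>: one degree belongs to the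
      \<open>dx\<^sub>j\<close> and one to the factor \<open>x\<^sub>0\<close> to be split
      off.\<close>
    then obtain e where e: "d = Suc e" "e \<ge> reg_index n I" using d by (cases d) auto
    then show ?thesis using homogeneous_kernel_in_koszul_reg[of F e] F w(1) by simp
  qed
qed

text \<open>Lying in the kernel means that a polynomial lies in the homogeneous ideal
  \<open>I\<close>, and this passes to components. Hence every element of the kernel is a sum of
  homogeneous elements of the kernel.\<close>

lemma kernel_subset_koszul:
  assumes "\<And>i. i \<ge> 1 \<Longrightarrow> euler_kernel n I \<inter> omega_part n I i \<subseteq> U"
  shows "euler_kernel n I \<subseteq> U"
proof
  fix w assume w: "w \<in> euler_kernel n I"
  then have "w \<in> carrier M" by (simp add: euler_kernel_eq)
  then obtain F where F: "\<And>j. F j \<in> pcarrier n" "w = dform F" using dform_surj by blast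
  have comp: "dform (\<lambda>j. hcomp d (F j)) \<in> U" for d
  proof -
    have "(\<Sum>j\<le>n. F j * pvar j) \<in> I" using dform_in_kernel_iff[of F] F w by simp
    \<comment> \<open>The degree is \<open>Suc d\<close> because \<open>pvar j\<close> adds one to
      the degree of the coefficient.\<close>
    then have "hcomp (Suc d) (\<Sum>j\<le>n. F j * pvar j) \<in> I"
      using I_homogeneous by (simp add: homogeneous_ideal_iff)
    also have "hcomp (Suc d) (\<Sum>j\<le>n. F j * pvar j) = (\<Sum>j\<le>n. hcomp d (F j) * pvar j)"
      unfolding hcomp_sum
    proof (intro sum.cong refl)
      fix j
      show "hcomp (Suc d) (F j * pvar j) = hcomp d (F j) * pvar j"
        using hcomp_mult_homog[of 1 "pvar j" "F j" n "Suc d"] F(1) by (simp add: mult.commute)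
    qed
    finally have "dform (\<lambda>j. hcomp d (F j)) \<in> euler_kernel n I"
      using F(1) by (subst dform_in_kernel_iff) auto
    moreover have "dform (\<lambda>j. hcomp d (F j)) \<in> omega_part n I (Suc d)"
      using F(1) by (auto simp: omega_part_Suc ppart_iff)
    ultimately show ?thesis using assms[of "Suc d"] by auto
  qed
  have "\<forall>j. \<exists>B. \<forall>m\<in>Poly_Mapping.keys (F j). mon_deg m \<le> B" using mon_deg_bound by metis
  then obtain B where B: "\<And>j m. m \<in> Poly_Mapping.keys (F j) \<Longrightarrow> mon_deg m \<le> B j" by metis
  \<comment> \<open>One bound for the degrees of all coefficients, so that the same range of
    components recovers each of them.\<close>
  define C where "C = Max (B ` {..n})"
  have C: "mon_deg m \<le> C" if "j \<le> n" "m \<in> Poly_Mapping.keys (F j)" for j m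
  proof -
    have "B j \<le> C" unfolding C_def by (rule Max_ge) (use that(1) in auto)
    then show ?thesis using B[OF that(2)] by simp
  qed
  have "dform (\<lambda>j. \<Sum>d\<in>D. hcomp d (F j)) \<in> U" if "finite D" for D
    using that
  proof (induction D)
    case empty
    then show ?case using U_D(7) by (simp add: dform_zero)
  next
    case (insert d D)
    have "(\<Sum>d\<in>D. hcomp d (F j)) \<in> pcarrier n" for j
      by (rule pcarrier_sum) (use F(1) in auto)
    then show ?case using insert F(1) comp U_D(5) by (simp add: dform_add)
  qed
  from this[of "{..C}"] have "dform (\<lambda>j. \<Sum>d\<le>C. hcomp d (F j)) \<in> U" by simp
  moreover have "dform (\<lambda>j. \<Sum>d\<le>C. hcomp d (F j)) = dform F"
    unfolding dform_def
  proof (intro M.M.finsum_cong' refl)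
    fix j assume "j \<in> {..n}"
    then have "(\<Sum>d\<le>C. hcomp d (F j)) = F j" using C by (intro sum_hcomp) auto
    then show "cl (\<Sum>d\<le>C. hcomp d (F j)) \<odot>\<^bsub>M\<^esub> dx j = cl (F j) \<odot>\<^bsub>M\<^esub> dx j" by simp
  qed (use F(1) in auto)
  ultimately show "w \<in> U" using F(2) by simp
qed

end

section \<open>Conditions on the characteristic and the resulting equalities\<close>

lemma CHAR_field_not_one: "CHAR('k::field) \<noteq> 1"
  using of_nat_eq_0_iff_char_dvd[of 1, where 'a = 'k] by auto

theorem proposition4p4:
  fixes n :: nat and I :: "'k::field mpoly set"
  assumes "perfect_field TYPE('k)"
    and "n \<ge> 1"
    and "zero_dim_subscheme n I"
    and "\<forall>\<pp>\<in>scheme_points n I. pvar 0 \<notin> \<pp>"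
  shows "(koszul n I \<subseteq> euler_kernel n I \<and>
          (CHAR('k) = 0 \<or> CHAR('k) \<ge> 2 * reg_index n I + 1 \<longrightarrow> koszul n I = euler_kernel n I))
       \<and> (CHAR('k) > 0 \<longrightarrow>
          (\<forall>i. (i \<ge> 1 \<and> \<not> CHAR('k) dvd i) \<or> i \<ge> 2 * reg_index n I + 1 \<longrightarrow>
             koszul n I \<inter> omega_part n I i = euler_kernel n I \<inter> omega_part n I i))
       \<and> euler_kernel n I =
          {w \<in> carrier (Omega n I). rvar n I 0 \<odot>\<^bsub>Omega n I\<^esub> w \<in> koszul n I}"
proof -
  interpret zero_dim_off_hyperplane n I
    by unfold_locales (use assms in auto)
  let ?r = "reg_index n I"
  have sub: "U \<subseteq> euler_kernel n I" by (rule koszul_subset_kernel)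
  have deg: "euler_kernel n I \<inter> omega_part n I i \<subseteq> U"
    if i: "i \<ge> 1" "\<not> CHAR('k) dvd i \<or> i \<ge> 2 * ?r + 1" for i
  proof -
    obtain d where d: "i = Suc d" using i(1) by (cases i) auto
    have "of_nat (Suc d) \<noteq> (0 :: 'k) \<or> Suc d \<ge> ?r + 2"
    proof (cases "CHAR('k) dvd i")
      case True
      \<comment> \<open>The characteristic of a field is not \<open>1\<close>, so
        \<open>i \<ge> 2\<close>. This settles \<open>?r = 0\<close>, where
        \<open>2 * ?r + 1\<close> falls short of \<open>?r + 2\<close>; for positive
        \<open>?r\<close> it does not.\<close>
      then have "i \<noteq> 1" using CHAR_field_not_one[where 'k = 'k] by auto
      then show ?thesis using i True d by linarith
    next
      case False
      then show ?thesis using d by (simp add: of_nat_eq_0_iff_char_dvd del: of_nat_Suc)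
    qed
    then show ?thesis using kernel_omega_part_Suc[of _ d] d by blast
  qed
  have "U = euler_kernel n I" if p: "CHAR('k) = 0 \<or> CHAR('k) \<ge> 2 * ?r + 1"
  proof -
    have "euler_kernel n I \<subseteq> U"
    proof (rule kernel_subset_koszul[OF deg])
      fix i :: nat assume i: "i \<ge> 1"
      \<comment> \<open>In characteristic \<open>0\<close> no positive \<open>i\<close> is divisible
        by it; otherwise a positive multiple of the characteristic is at least the characteristic,
        hence at least \<open>2 * ?r + 1\<close>.\<close>
      show "\<not> CHAR('k) dvd i \<or> i \<ge> 2 * ?r + 1"
        using p i dvd_imp_le[of "CHAR('k)" i] by auto
    qed
    then show ?thesis using sub by blast
  qed
  moreover have "U \<inter> omega_part n I i = euler_kernel n I \<inter> omega_part n I i"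
    if "(i \<ge> 1 \<and> \<not> CHAR('k) dvd i) \<or> i \<ge> 2 * ?r + 1" for i
  proof -
    have "i \<ge> 1" "\<not> CHAR('k) dvd i \<or> i \<ge> 2 * ?r + 1" using that by auto
    from deg[OF this] show ?thesis using sub by blast
  qed
  ultimately show ?thesis using sub kernel_iff_x0_smult by blast
qed

end
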